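(* Let $\mathfrak g$ and $\mathfrak h$ be two Lie-Yamaguti algebras over a field $k$. Then the equivalence classes of non-abelian extensions of $\mathfrak g$ by $\mathfrak h$ are classified by $H^{(2,3)}_{nab}(\mathfrak g,\mathfrak h)$: assigning to an extension $0\to\mathfrak h\to\hat{\mathfrak g}\xrightarrow{p}\mathfrak g\to0$ the class of the non-abelian $(2,3)$-cocycle induced by a section of $p$ gives a bijection $$\mathcal E_{nab}(\mathfrak g,\mathfrak h)\;\simeq\; H^{(2,3)}_{nab}(\mathfrak g,\mathfrak h)$$ from the set $\mathcal E_{nab}(\mathfrak g,\mathfrak h)$ of equivalence classes of non-abelian extensions of $\mathfrak g$ by $\mathfrak h$ to the set of equivalence classes of non-abelian $(2,3)$-cocycles on $\mathfrak g$ with values in $\mathfrak h$.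
   Context: **Lie-Yamaguti algebras.** A Lie-Yamaguti algebra over $k$ is a vector space $\mathfrak g$ with a bilinear map $[\cdot,\cdot]$ and a trilinear map $\{\cdot,\cdot,\cdot\}$ (values in $\mathfrak g$) such that for all elements (LY1) $[x_1,x_2]+[x_2,x_1]=0$, $\{x_1,x_2,x_3\}+\{x_2,x_1,x_3\}=0$; (LY2) $[[x_1,x_2],x_3]+[[x_2,x_3],x_1]+[[x_3,x_1],x_2]+\{x_1,x_2,x_3\}+\{x_2,x_3,x_1\}+\{x_3,x_1,x_2\}=0$; (LY3) $\{[x_1,x_2],x_3,y_1\}+\{[x_2,x_3],x_1,y_1\}+\{[x_3,x_1],x_2,y_1\}=0$; (LY4) $\{x_1,x_2,[y_1,y_2]\}=[\{x_1,x_2,y_1\},y_2]+[y_1,\{x_1,x_2,y_2\}]$; (LY5) $\{x_1,x_2,\{y_1,y_2,y_3\}\}=\{\{x_1,x_2,y_1\},y_2,y_3\}+\{y_1,\{x_1,x_2,y_2\},y_3\}+\{y_1,y_2,\{x_1,x_2,y_3\}\}$. Homomorphisms are linear maps preserving both operations. **Extensions.** A non-abelian extension of $\mathfrak g$ by $\mathfrak h$ is a short exact sequence of Lie-Yamaguti algebras $0\to\mathfrak h\xrightarrow{i}\hat{\mathfrak g}\xrightarrow{p}\mathfrak g\to0$; $\mathfrak h$ is identified with $i(\mathfrak h)$. A section of $p$ is a linear map $s:\mathfrak g\to\hat{\mathfrak g}$ with $ps=I_{\mathfrak g}$. Two extensions $\hat{\mathfrak g}_1,\hat{\mathfrak g}_2$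 (with maps $i_j,p_j$) are equivalent if there is a Lie-Yamaguti homomorphism $f:\hat{\mathfrak g}_1\to\hat{\mathfrak g}_2$ with $f i_1=i_2$, $p_2f=p_1$. **Cocycle induced by a section $s$.** For $x,y,z\in\mathfrak g$, $a,b\in\mathfrak h$: $\chi_s(x,y)=[s(x),s(y)]_{\hat{\mathfrak g}}-s[x,y]_{\mathfrak g}$, $\omega_s(x,y,z)=\{s(x),s(y),s(z)\}_{\hat{\mathfrak g}}-s\{x,y,z\}_{\mathfrak g}$, $\mu_s(x)a=[s(x),a]_{\hat{\mathfrak g}}$, $\theta_s(x,y)a=\{a,s(x),s(y)\}_{\hat{\mathfrak g}}$, $D_s(x,y)a=\{s(x),s(y),a\}_{\hat{\mathfrak g}}$, $\rho_s(x)(a,b)=\{s(x),a,b\}_{\hat{\mathfrak g}}$, $T_s(x)(a,b)=\{a,b,s(x)\}_{\hat{\mathfrak g}}$. **Non-abelian $(2,3)$-cocycles.** A non-abelian $(2,3)$-cocycle on $\mathfrak g$ with values in $\mathfrak h$ is a septuple $(\chi,\omega,\mu,\theta,D,\rho,T)$ of (multi)linear maps $\chi:\mathfrak g\otimes\mathfrak g\to\mathfrak h$, $\omega:\mathfrak g^{\otimes3}\to\mathfrak h$, $\mu:\mathfrak g\to\mathfrak{gl}(\mathfrak h)$, $\theta,D:\mathfrak g\otimes\mathfrak g\to\mathfrak{gl}(\mathfrak h)$, $\rho,T:\mathfrak g\to\mathrm{Hom}(\mathfrak h\otimes\mathfrak h,\mathfrak h)$ such that for all $x,y,z,w,x_i,y_i\in\mathfrak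 g$ and $a,b,c,d\in\mathfrak h$ (brackets of $\mathfrak g$ and of $\mathfrak h$ are written without subscripts): (i) $\chi(x,y)+\chi(y,x)=0$; $\omega(x,y,z)+\omega(y,x,z)=0$; $D(x,y)a+D(y,x)a=0$; $T(x)(a,b)+T(x)(b,a)=0$. (ii) $\chi([x,y],z)-\mu(z)\chi(x,y)+\omega(x,y,z)+\chi([y,z],x)-\mu(x)\chi(y,z)+\omega(y,z,x)+\chi([z,x],y)-\mu(y)\chi(z,x)+\omega(z,x,y)=0$; $\mu([x,y])a+[\chi(x,y),a]+D(x,y)a-\mu(x)\mu(y)a-\theta(y,x)a+\mu(y)\mu(x)a+\theta(x,y)a=0$; $[\mu(x)a,b]+\rho(x)(a,b)-\mu(x)[a,b]+T(x)(a,b)-[\mu(x)b,a]-\rho(x)(b,a)=0$. (iii) $\omega([x,y],z,w)+\omega([y,z],x,w)+\omega([z,x],y,w)+\theta(z,w)\chi(x,y)+\theta(x,w)\chi(y,z)+\theta(y,w)\chi(z,x)=0$; $D([x,y],z)a-\rho(z)(\chi(x,y),a)+D([y,z],x)a-\rho(x)(\chi(y,z),a)+D([z,x],y)a-\rho(y)(\chi(z,x),a)=0$; $\theta([x,y],z)a-T(z)(\chi(x,y),a)-\theta(x,z)\mu(y)a+\theta(y,z)\mu(x)a=0$; $\rho([x,y])(a,b)+\{\chi(x,y),a,b\}-\rho(x)(\mu(y)a,b)+\rho(y)(\mu(x)a,b)=0$; $T(y)(\mu(x)a,b)+\theta(x,y)[a,b]-T(y)(\mu(x)b,a)=0$; $\{\mu(x)a,b,c\}-\rho(x)([a,b],c)-\{\mu(x)b,a,c\}=0$;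 $T(x)([a,b],c)+T(x)([b,c],a)+T(x)([c,a],b)=0$. (iv) $\omega(x,y,[z,w])+D(x,y)\chi(z,w)=\chi(\{x,y,z\},w)-\mu(w)\omega(x,y,z)+\mu(z)\omega(x,y,w)+\chi(z,\{x,y,w\})$; $D(x,y)\mu(z)a=\mu(\{x,y,z\})a+[\omega(x,y,z),a]+\mu(z)D(x,y)a$; $\theta(x,[y,z])a-\rho(x)(a,\chi(y,z))=\mu(y)\theta(x,z)a-\mu(z)\theta(x,y)a$; $D(x,y)[a,b]=[D(x,y)a,b]+[a,D(x,y)b]$; $\rho(x)(a,\mu(y)b)+[\theta(x,y)a,b]-\mu(y)\rho(x)(a,b)=0$; $T([x,y])(a,b)+\{a,b,\chi(x,y)\}-\mu(x)T(y)(a,b)+\mu(y)T(x)(a,b)=0$; $\{a,b,\mu(x)c\}=\mu(x)\{a,b,c\}-[c,T(x)(a,b)]$; $\rho(x)(a,[b,c])=[\rho(x)(a,b),c]+[b,\rho(x)(a,c)]$. (v) $D(x_1,x_2)\omega(y_1,y_2,y_3)+\omega(x_1,x_2,\{y_1,y_2,y_3\})=\omega(\{x_1,x_2,y_1\},y_2,y_3)+\theta(y_2,y_3)\omega(x_1,x_2,y_1)+\omega(y_1,\{x_1,x_2,y_2\},y_3)-\theta(y_1,y_3)\omega(x_1,x_2,y_2)+\omega(y_1,y_2,\{x_1,x_2,y_3\})+D(y_1,y_2)\omega(x_1,x_2,y_3)$; $D(x,y)\theta(z,w)a-\theta(z,w)D(x,y)a=\theta(\{x,y,z\},w)a+\theta(z,\{x,y,w\})a-T(w)(\omega(x,y,z),a)-\rho(z)(a,\omega(x,y,w))$;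 $\theta(x,\{y,z,w\})a-\rho(x)(a,\omega(y,z,w))=\theta(z,w)\theta(x,y)a-\theta(y,w)\theta(x,z)a+D(y,z)\theta(x,w)a$; $D(x,y)D(z,w)a-D(z,w)D(x,y)a=D(\{x,y,z\},w)a+D(z,\{x,y,w\})a-\rho(w)(\omega(x,y,z),a)+\rho(z)(\omega(x,y,w),a)$; $D(x,y)\rho(z)(a,b)-\rho(\{x,y,z\})(a,b)=\rho(z)(D(x,y)a,b)+\rho(z)(a,D(x,y)b)+\{\omega(x,y,z),a,b\}$; $D(y,z)\rho(x)(a,b)=\rho(x)(a,D(y,z)b)-\rho(z)(\theta(x,y)a,b)+\rho(y)(\theta(x,z)a,b)$; $\theta(y,z)\rho(x)(a,b)=\rho(x)(a,\theta(y,z)b)-T(z)(\theta(x,y)a,b)-\rho(y)(b,\theta(x,z)a)$; $D(x,y)T(z)(a,b)-T(\{x,y,z\})(a,b)=T(z)(D(x,y)a,b)+T(z)(a,D(x,y)b)+\{a,b,\omega(x,y,z)\}$; $T(\{x,y,z\})(a,b)-D(x,y)T(z)(a,b)+\{a,b,\omega(x,y,z)\}=\theta(y,z)T(x)(a,b)-\theta(x,z)T(y)(a,b)$; $D(x,y)\{a,b,c\}=\{D(x,y)a,b,c\}+\{a,D(x,y)b,c\}+\{a,b,D(x,y)c\}$; $\rho(x)(a,\rho(y)(b,c))=\rho(y)(\rho(x)(a,b),c)+\rho(y)(b,\rho(x)(a,c))-\{\theta(x,y)a,b,c\}$; $\{a,b,\theta(x,y)c\}=\theta(x,y)\{a,b,c\}-T(y)(T(x)(a,b),c)-\rho(x)(c,T(y)(a,b))$;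 $\rho(x)(a,T(y)(b,c))=T(y)(\rho(x)(a,b),c)+T(y)(b,\rho(x)(a,c))-\{b,c,\theta(x,y)a\}$; $\{a,b,D(x,y)c\}=D(x,y)\{a,b,c\}-\rho(y)(T(x)(a,b),c)+\rho(x)(T(y)(a,b),c)$; $\{a,b,\rho(x)(c,d)\}=\rho(x)(\{a,b,c\},d)-\{c,T(x)(a,b),d\}+\rho(x)(c,\{a,b,d\})$; $\rho(x)(a,\{b,c,d\})=\{\rho(x)(a,b),c,d\}+\{b,\rho(x)(a,c),d\}+\{b,c,\rho(x)(a,d)\}$; $\{a,b,T(x)(c,d)\}=T(x)(\{a,b,c\},d)+T(x)(c,\{a,b,d\})+\{c,d,T(x)(a,b)\}$. **Equivalence of cocycles.** $(\chi_1,\omega_1,\mu_1,\theta_1,D_1,\rho_1,T_1)$ and $(\chi_2,\omega_2,\mu_2,\theta_2,D_2,\rho_2,T_2)$ are equivalent if there is a linear map $\varphi:\mathfrak g\to\mathfrak h$ such that for all $x,y,z\in\mathfrak g$, $a,b\in\mathfrak h$: $\chi_1(x,y)-\chi_2(x,y)=[\varphi(x),\varphi(y)]+\varphi[x,y]-\mu_2(x)\varphi(y)+\mu_2(y)\varphi(x)$; $\omega_1(x,y,z)-\omega_2(x,y,z)=\theta_2(x,z)\varphi(y)-D_2(x,y)\varphi(z)+\rho_2(x)(\varphi(y),\varphi(z))-\theta_2(y,z)\varphi(x)+T_2(z)(\varphi(x),\varphi(y))-\rho_2(y)(\varphi(x),\varphi(z))-\{\varphi(x),\varphi(y),\varphi(z)\}+\varphi\{x,y,z\}$;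 $\mu_1(x)a-\mu_2(x)a=[a,\varphi(x)]$; $\theta_1(x,y)a-\theta_2(x,y)a=\rho_2(x)(a,\varphi(y))-T_2(y)(a,\varphi(x))+\{a,\varphi(x),\varphi(y)\}$; $D_1(x,y)a-D_2(x,y)a=\rho_2(y)(\varphi(x),a)-\rho_2(x)(\varphi(y),a)+\{\varphi(x),\varphi(y),a\}$; $\rho_1(x)(a,b)-\rho_2(x)(a,b)=\{a,\varphi(x),b\}$; $T_1(x)(a,b)-T_2(x)(a,b)=\{b,a,\varphi(x)\}$. $H^{(2,3)}_{nab}(\mathfrak g,\mathfrak h)$ denotes the set of equivalence classes of non-abelian $(2,3)$-cocycles. *)

theory Defs
  imports Complex_Main "HOL-Library.Product_Plus"
begin

section \<open>Lie-Yamaguti algebras\<close>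

text \<open>
  The carrier of an algebra is a linear subspace of the vector space formed by its type and
  \<^verbatim>\<open>smult\<close>; the addition is that of the type. The algebras g and h of the classification live
  on a whole type (carrier \<^term>\<open>UNIV\<close>); proper subspaces are needed for the middle terms of
  extensions, which all have to be elements of one type.
\<close>

record ('k, 'a) ly_algebra =
  smult :: "'k \<Rightarrow> 'a \<Rightarrow> 'a"
  carrier :: "'a set"
  brk :: "'a \<Rightarrow> 'a \<Rightarrow> 'a"
  trp :: "'a \<Rightarrow> 'a \<Rightarrow> 'a \<Rightarrow> 'a"

abbreviation ly_brk (\<open>[_, _]\<^bsub>_\<^esub>\<close>)
  where "[x, y]\<^bsub>A\<^esub> \<equiv> brk A x y"

abbreviation ly_trp (\<open>{_, _, _}\<^bsub>_\<^esub>\<close>)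
  where "{x, y, z}\<^bsub>A\<^esub> \<equiv> trp A x y z"

text \<open>Values outside the carrier of \<^verbatim>\<open>A\<close> are irrelevant.\<close>

definition linear_map ::
  "('k::field, 'a::ab_group_add) ly_algebra \<Rightarrow> ('k, 'b::ab_group_add) ly_algebra \<Rightarrow> ('a \<Rightarrow> 'b) \<Rightarrow> bool"
  where "linear_map A B f \<longleftrightarrow>
    (\<forall>x\<in>carrier A. f x \<in> carrier B) \<and>
    (\<forall>x\<in>carrier A. \<forall>y\<in>carrier A. f (x + y) = f x + f y) \<and>
    (\<forall>c. \<forall>x\<in>carrier A. f (smult A c x) = smult B c (f x))"

locale lie_yamaguti = vector_space "smult A"
  for A :: "('k::field, 'a::ab_group_add) ly_algebra" +
  assumes subspace_carrier: "subspace (carrier A)"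
    and brk_linear:
      "y \<in> carrier A \<Longrightarrow> linear_map A A (\<lambda>x. [x, y]\<^bsub>A\<^esub>)"
      "x \<in> carrier A \<Longrightarrow> linear_map A A (\<lambda>y. [x, y]\<^bsub>A\<^esub>)"
    and trp_linear:
      "y \<in> carrier A \<Longrightarrow> z \<in> carrier A \<Longrightarrow> linear_map A A (\<lambda>x. {x, y, z}\<^bsub>A\<^esub>)"
      "x \<in> carrier A \<Longrightarrow> z \<in> carrier A \<Longrightarrow> linear_map A A (\<lambda>y. {x, y, z}\<^bsub>A\<^esub>)"
      "x \<in> carrier A \<Longrightarrow> y \<in> carrier A \<Longrightarrow> linear_map A A (\<lambda>z. {x, y, z}\<^bsub>A\<^esub>)"
    and LY1:
      "x1 \<in> carrier A \<Longrightarrow> x2 \<in> carrier A \<Longrightarrow> [x1, x2]\<^bsub>A\<^esub> + [x2, x1]\<^bsub>A\<^esub> = 0"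
      "x1 \<in> carrier A \<Longrightarrow> x2 \<in> carrier A \<Longrightarrow> x3 \<in> carrier A \<Longrightarrow>
        {x1, x2, x3}\<^bsub>A\<^esub> + {x2, x1, x3}\<^bsub>A\<^esub> = 0"
    and LY2:
      "x1 \<in> carrier A \<Longrightarrow> x2 \<in> carrier A \<Longrightarrow> x3 \<in> carrier A \<Longrightarrow>
        [[x1, x2]\<^bsub>A\<^esub>, x3]\<^bsub>A\<^esub> + [[x2, x3]\<^bsub>A\<^esub>, x1]\<^bsub>A\<^esub> + [[x3, x1]\<^bsub>A\<^esub>, x2]\<^bsub>A\<^esub>
        + {x1, x2, x3}\<^bsub>A\<^esub> + {x2, x3, x1}\<^bsub>A\<^esub> + {x3, x1, x2}\<^bsub>A\<^esub> = 0"
    and LY3: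
      "x1 \<in> carrier A \<Longrightarrow> x2 \<in> carrier A \<Longrightarrow> x3 \<in> carrier A \<Longrightarrow> y1 \<in> carrier A \<Longrightarrow>
        {[x1, x2]\<^bsub>A\<^esub>, x3, y1}\<^bsub>A\<^esub> + {[x2, x3]\<^bsub>A\<^esub>, x1, y1}\<^bsub>A\<^esub> + {[x3, x1]\<^bsub>A\<^esub>, x2, y1}\<^bsub>A\<^esub> = 0"
    and LY4:
      "x1 \<in> carrier A \<Longrightarrow> x2 \<in> carrier A \<Longrightarrow> y1 \<in> carrier A \<Longrightarrow> y2 \<in> carrier A \<Longrightarrow>
        {x1, x2, [y1, y2]\<^bsub>A\<^esub>}\<^bsub>A\<^esub> = [{x1, x2, y1}\<^bsub>A\<^esub>, y2]\<^bsub>A\<^esub> + [y1, {x1, x2, y2}\<^bsub>A\<^esub>]\<^bsub>A\<^esub>"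
    and LY5:
      "x1 \<in> carrier A \<Longrightarrow> x2 \<in> carrier A \<Longrightarrow>
        y1 \<in> carrier A \<Longrightarrow> y2 \<in> carrier A \<Longrightarrow> y3 \<in> carrier A \<Longrightarrow>
        {x1, x2, {y1, y2, y3}\<^bsub>A\<^esub>}\<^bsub>A\<^esub> =
          {{x1, x2, y1}\<^bsub>A\<^esub>, y2, y3}\<^bsub>A\<^esub> + {y1, {x1, x2, y2}\<^bsub>A\<^esub>, y3}\<^bsub>A\<^esub>
          + {y1, y2, {x1, x2, y3}\<^bsub>A\<^esub>}\<^bsub>A\<^esub>"

definition ly_hom ::
  "('k::field, 'a::ab_group_add) ly_algebra \<Rightarrow> ('k, 'b::ab_group_add) ly_algebra \<Rightarrow> ('a \<Rightarrow> 'b) \<Rightarrow> bool"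
  where "ly_hom A B f \<longleftrightarrow> linear_map A B f \<and>
    (\<forall>x\<in>carrier A. \<forall>y\<in>carrier A. f [x, y]\<^bsub>A\<^esub> = [f x, f y]\<^bsub>B\<^esub>) \<and>
    (\<forall>x\<in>carrier A. \<forall>y\<in>carrier A. \<forall>z\<in>carrier A. f {x, y, z}\<^bsub>A\<^esub> = {f x, f y, f z}\<^bsub>B\<^esub>)"


section \<open>Non-abelian extensions\<close>

record ('k, 'g, 'h, 'e) extension =
  mid :: "('k, 'e) ly_algebra"
  inc :: "'h \<Rightarrow> 'e"
  prj :: "'e \<Rightarrow> 'g"

definition is_extension ::
  "('k::field, 'g::ab_group_add) ly_algebra \<Rightarrow> ('k, 'h::ab_group_add) ly_algebra \<Rightarrow>
    ('k, 'g, 'h, 'e::ab_group_add) extension \<Rightarrow> bool"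
  where "is_extension G H X \<longleftrightarrow>
    lie_yamaguti (mid X) \<and>
    ly_hom H (mid X) (inc X) \<and> ly_hom (mid X) G (prj X) \<and>
    inj_on (inc X) (carrier H) \<and>
    inc X ` carrier H = {e \<in> carrier (mid X). prj X e = 0} \<and>
    prj X ` carrier (mid X) = carrier G"

definition extension_equiv ::
  "('k::field, 'g::ab_group_add) ly_algebra \<Rightarrow> ('k, 'h::ab_group_add) ly_algebra \<Rightarrow>
    ('k, 'g, 'h, 'e::ab_group_add) extension rel"
  where "extension_equiv G H = {(X1, X2). is_extension G H X1 \<and> is_extension G H X2 \<and>
    (\<exists>f. ly_hom (mid X1) (mid X2) f \<and>
         (\<forall>a\<in>carrier H. f (inc X1 a) = inc X2 a) \<and>
         (\<forall>e\<in>carrier (mid X1). prj X2 (f e) = prj X1 e))}"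

definition E_nab ::
  "('k::field, 'g::ab_group_add) ly_algebra \<Rightarrow> ('k, 'h::ab_group_add) ly_algebra \<Rightarrow>
    ('k, 'g, 'h, 'e::ab_group_add) extension set set"
  where "E_nab G H = {X. is_extension G H X} // extension_equiv G H"

definition is_section ::
  "('k::field, 'g::ab_group_add) ly_algebra \<Rightarrow> ('k, 'g, 'h, 'e::ab_group_add) extension \<Rightarrow>
    ('g \<Rightarrow> 'e) \<Rightarrow> bool"
  where "is_section G X s \<longleftrightarrow> linear_map G (mid X) s \<and> (\<forall>x\<in>carrier G. prj X (s x) = x)"


section \<open>Non-abelian (2,3)-cocycles\<close>

record ('g, 'h) septuple =
  c_chi :: "'g \<Rightarrow> 'g \<Rightarrow> 'h"
  c_omega :: "'g \<Rightarrow> 'g \<Rightarrow> 'g \<Rightarrow> 'h"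
  c_mu :: "'g \<Rightarrow> 'h \<Rightarrow> 'h"
  c_theta :: "'g \<Rightarrow> 'g \<Rightarrow> 'h \<Rightarrow> 'h"
  c_D :: "'g \<Rightarrow> 'g \<Rightarrow> 'h \<Rightarrow> 'h"
  c_rho :: "'g \<Rightarrow> 'h \<Rightarrow> 'h \<Rightarrow> 'h"
  c_T :: "'g \<Rightarrow> 'h \<Rightarrow> 'h \<Rightarrow> 'h"

text \<open>From here on \<^verbatim>\<open>G\<close> and \<^verbatim>\<open>H\<close> are understood to have carrier \<^term>\<open>UNIV\<close>.\<close>

locale nonabelian_cocycle =
  fixes G :: "('k::field, 'g::ab_group_add) ly_algebra"
    and H :: "('k, 'h::ab_group_add) ly_algebra"
    and \<chi> :: "'g \<Rightarrow> 'g \<Rightarrow> 'h"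
    and \<omega> :: "'g \<Rightarrow> 'g \<Rightarrow> 'g \<Rightarrow> 'h"
    and \<mu> :: "'g \<Rightarrow> 'h \<Rightarrow> 'h"
    and \<theta> :: "'g \<Rightarrow> 'g \<Rightarrow> 'h \<Rightarrow> 'h"
    and D :: "'g \<Rightarrow> 'g \<Rightarrow> 'h \<Rightarrow> 'h"
    and \<rho> :: "'g \<Rightarrow> 'h \<Rightarrow> 'h \<Rightarrow> 'h"
    and T :: "'g \<Rightarrow> 'h \<Rightarrow> 'h \<Rightarrow> 'h"
  assumes chi_linear:
      "linear_map G H (\<lambda>x. \<chi> x y)"
      "linear_map G H (\<lambda>y. \<chi> x y)"
    and omega_linear:
      "linear_map G H (\<lambda>x. \<omega> x y z)"
      "linear_map G H (\<lambda>y. \<omega> x y z)"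
      "linear_map G H (\<lambda>z. \<omega> x y z)"
    and mu_linear:
      "linear_map G H (\<lambda>x. \<mu> x a)"
      "linear_map H H (\<lambda>a. \<mu> x a)"
    and theta_linear:
      "linear_map G H (\<lambda>x. \<theta> x y a)"
      "linear_map G H (\<lambda>y. \<theta> x y a)"
      "linear_map H H (\<lambda>a. \<theta> x y a)"
    and D_linear:
      "linear_map G H (\<lambda>x. D x y a)"
      "linear_map G H (\<lambda>y. D x y a)"
      "linear_map H H (\<lambda>a. D x y a)"
    and rho_linear:
      "linear_map G H (\<lambda>x. \<rho> x a b)"
      "linear_map H H (\<lambda>a. \<rho> x a b)"
      "linear_map H H (\<lambda>b. \<rho> x a b)"
    and T_linear:
      "linear_map G H (\<lambda>x. T x a b)"
      "linear_map H H (\<lambda>a. T x a b)"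
      "linear_map H H (\<lambda>b. T x a b)"
    and cocycle_i:
      "\<chi> x y + \<chi> y x = 0"
      "\<omega> x y z + \<omega> y x z = 0"
      "D x y a + D y x a = 0"
      "T x a b + T x b a = 0"
    and cocycle_ii:
      "\<chi> [x, y]\<^bsub>G\<^esub> z - \<mu> z (\<chi> x y) + \<omega> x y z
        + \<chi> [y, z]\<^bsub>G\<^esub> x - \<mu> x (\<chi> y z) + \<omega> y z x
        + \<chi> [z, x]\<^bsub>G\<^esub> y - \<mu> y (\<chi> z x) + \<omega> z x y = 0"
      "\<mu> [x, y]\<^bsub>G\<^esub> a + [\<chi> x y, a]\<^bsub>H\<^esub> + D x y a
        - \<mu> x (\<mu> y a) - \<theta> y x a + \<mu> y (\<mu> x a) + \<theta> x y a = 0"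
      "[\<mu> x a, b]\<^bsub>H\<^esub> + \<rho> x a b - \<mu> x [a, b]\<^bsub>H\<^esub> + T x a b - [\<mu> x b, a]\<^bsub>H\<^esub> - \<rho> x b a = 0"
    and cocycle_iii:
      "\<omega> [x, y]\<^bsub>G\<^esub> z w + \<omega> [y, z]\<^bsub>G\<^esub> x w + \<omega> [z, x]\<^bsub>G\<^esub> y w
        + \<theta> z w (\<chi> x y) + \<theta> x w (\<chi> y z) + \<theta> y w (\<chi> z x) = 0"
      "D [x, y]\<^bsub>G\<^esub> z a - \<rho> z (\<chi> x y) a + D [y, z]\<^bsub>G\<^esub> x a - \<rho> x (\<chi> y z) a
        + D [z, x]\<^bsub>G\<^esub> y a - \<rho> y (\<chi> z x) a = 0"
      "\<theta> [x, y]\<^bsub>G\<^esub> z a - T z (\<chi> x y) a - \<theta> x z (\<mu> y a) + \<theta> y z (\<mu> x a) = 0"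
      "\<rho> [x, y]\<^bsub>G\<^esub> a b + {\<chi> x y, a, b}\<^bsub>H\<^esub> - \<rho> x (\<mu> y a) b + \<rho> y (\<mu> x a) b = 0"
      "T y (\<mu> x a) b + \<theta> x y [a, b]\<^bsub>H\<^esub> - T y (\<mu> x b) a = 0"
      "{\<mu> x a, b, c}\<^bsub>H\<^esub> - \<rho> x [a, b]\<^bsub>H\<^esub> c - {\<mu> x b, a, c}\<^bsub>H\<^esub> = 0"
      "T x [a, b]\<^bsub>H\<^esub> c + T x [b, c]\<^bsub>H\<^esub> a + T x [c, a]\<^bsub>H\<^esub> b = 0"
    and cocycle_iv:
      "\<omega> x y [z, w]\<^bsub>G\<^esub> + D x y (\<chi> z w) =
        \<chi> {x, y, z}\<^bsub>G\<^esub> w - \<mu> w (\<omega> x y z) + \<mu> z (\<omega> x y w) + \<chi> z {x, y, w}\<^bsub>G\<^esub>"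
      "D x y (\<mu> z a) = \<mu> {x, y, z}\<^bsub>G\<^esub> a + [\<omega> x y z, a]\<^bsub>H\<^esub> + \<mu> z (D x y a)"
      "\<theta> x [y, z]\<^bsub>G\<^esub> a - \<rho> x a (\<chi> y z) = \<mu> y (\<theta> x z a) - \<mu> z (\<theta> x y a)"
      "D x y [a, b]\<^bsub>H\<^esub> = [D x y a, b]\<^bsub>H\<^esub> + [a, D x y b]\<^bsub>H\<^esub>"
      "\<rho> x a (\<mu> y b) + [\<theta> x y a, b]\<^bsub>H\<^esub> - \<mu> y (\<rho> x a b) = 0"
      "T [x, y]\<^bsub>G\<^esub> a b + {a, b, \<chi> x y}\<^bsub>H\<^esub> - \<mu> x (T y a b) + \<mu> y (T x a b) = 0"
      "{a, b, \<mu> x c}\<^bsub>H\<^esub> = \<mu> x {a, b, c}\<^bsub>H\<^esub> - [c, T x a b]\<^bsub>H\<^esub>"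
      "\<rho> x a [b, c]\<^bsub>H\<^esub> = [\<rho> x a b, c]\<^bsub>H\<^esub> + [b, \<rho> x a c]\<^bsub>H\<^esub>"
    and cocycle_v:
      "D x1 x2 (\<omega> y1 y2 y3) + \<omega> x1 x2 {y1, y2, y3}\<^bsub>G\<^esub> =
        \<omega> {x1, x2, y1}\<^bsub>G\<^esub> y2 y3 + \<theta> y2 y3 (\<omega> x1 x2 y1)
        + \<omega> y1 {x1, x2, y2}\<^bsub>G\<^esub> y3 - \<theta> y1 y3 (\<omega> x1 x2 y2)
        + \<omega> y1 y2 {x1, x2, y3}\<^bsub>G\<^esub> + D y1 y2 (\<omega> x1 x2 y3)"
      "D x y (\<theta> z w a) - \<theta> z w (D x y a) =
        \<theta> {x, y, z}\<^bsub>G\<^esub> w a + \<theta> z {x, y, w}\<^bsub>G\<^esub> a - T w (\<omega> x y z) a - \<rho> z a (\<omega> x y w)"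
      "\<theta> x {y, z, w}\<^bsub>G\<^esub> a - \<rho> x a (\<omega> y z w) =
        \<theta> z w (\<theta> x y a) - \<theta> y w (\<theta> x z a) + D y z (\<theta> x w a)"
      "D x y (D z w a) - D z w (D x y a) =
        D {x, y, z}\<^bsub>G\<^esub> w a + D z {x, y, w}\<^bsub>G\<^esub> a - \<rho> w (\<omega> x y z) a + \<rho> z (\<omega> x y w) a"
      "D x y (\<rho> z a b) - \<rho> {x, y, z}\<^bsub>G\<^esub> a b =
        \<rho> z (D x y a) b + \<rho> z a (D x y b) + {\<omega> x y z, a, b}\<^bsub>H\<^esub>"
      "D y z (\<rho> x a b) = \<rho> x a (D y z b) - \<rho> z (\<theta> x y a) b + \<rho> y (\<theta> x z a) b"
      "\<theta> y z (\<rho> x a b) = \<rho> x a (\<theta> y z b) - T z (\<theta> x y a) b - \<rho> y b (\<theta> x z a)"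
      "D x y (T z a b) - T {x, y, z}\<^bsub>G\<^esub> a b =
        T z (D x y a) b + T z a (D x y b) + {a, b, \<omega> x y z}\<^bsub>H\<^esub>"
      "T {x, y, z}\<^bsub>G\<^esub> a b - D x y (T z a b) + {a, b, \<omega> x y z}\<^bsub>H\<^esub> =
        \<theta> y z (T x a b) - \<theta> x z (T y a b)"
      "D x y {a, b, c}\<^bsub>H\<^esub> = {D x y a, b, c}\<^bsub>H\<^esub> + {a, D x y b, c}\<^bsub>H\<^esub> + {a, b, D x y c}\<^bsub>H\<^esub>"
      "\<rho> x a (\<rho> y b c) = \<rho> y (\<rho> x a b) c + \<rho> y b (\<rho> x a c) - {\<theta> x y a, b, c}\<^bsub>H\<^esub>"
      "{a, b, \<theta> x y c}\<^bsub>H\<^esub> = \<theta> x y {a, b, c}\<^bsub>H\<^esub> - T y (T x a b) c - \<rho> x c (T y a b)"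
      "\<rho> x a (T y b c) = T y (\<rho> x a b) c + T y b (\<rho> x a c) - {b, c, \<theta> x y a}\<^bsub>H\<^esub>"
      "{a, b, D x y c}\<^bsub>H\<^esub> = D x y {a, b, c}\<^bsub>H\<^esub> - \<rho> y (T x a b) c + \<rho> x (T y a b) c"
      "{a, b, \<rho> x c d}\<^bsub>H\<^esub> = \<rho> x {a, b, c}\<^bsub>H\<^esub> d - {c, T x a b, d}\<^bsub>H\<^esub> + \<rho> x c {a, b, d}\<^bsub>H\<^esub>"
      "\<rho> x a {b, c, d}\<^bsub>H\<^esub> = {\<rho> x a b, c, d}\<^bsub>H\<^esub> + {b, \<rho> x a c, d}\<^bsub>H\<^esub> + {b, c, \<rho> x a d}\<^bsub>H\<^esub>"
      "{a, b, T x c d}\<^bsub>H\<^esub> = T x {a, b, c}\<^bsub>H\<^esub> d + T x c {a, b, d}\<^bsub>H\<^esub> + {c, d, T x a b}\<^bsub>H\<^esub>"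

definition is_cocycle ::
  "('k::field, 'g::ab_group_add) ly_algebra \<Rightarrow> ('k, 'h::ab_group_add) ly_algebra \<Rightarrow>
    ('g, 'h) septuple \<Rightarrow> bool"
  where "is_cocycle G H C \<longleftrightarrow>
    nonabelian_cocycle G H (c_chi C) (c_omega C) (c_mu C) (c_theta C) (c_D C) (c_rho C) (c_T C)"

definition cocycle_equiv ::
  "('k::field, 'g::ab_group_add) ly_algebra \<Rightarrow> ('k, 'h::ab_group_add) ly_algebra \<Rightarrow>
    ('g, 'h) septuple rel"
  where "cocycle_equiv G H = {(C1, C2). is_cocycle G H C1 \<and> is_cocycle G H C2 \<and>
    (\<exists>\<phi>. linear_map G H \<phi> \<and>
      (\<forall>x y. c_chi C1 x y - c_chi C2 x y =
        [\<phi> x, \<phi> y]\<^bsub>H\<^esub> + \<phi> [x, y]\<^bsub>G\<^esub> - c_mu C2 x (\<phi> y) + c_mu C2 y (\<phi> x)) \<and>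
      (\<forall>x y z. c_omega C1 x y z - c_omega C2 x y z =
        c_theta C2 x z (\<phi> y) - c_D C2 x y (\<phi> z) + c_rho C2 x (\<phi> y) (\<phi> z)
        - c_theta C2 y z (\<phi> x) + c_T C2 z (\<phi> x) (\<phi> y) - c_rho C2 y (\<phi> x) (\<phi> z)
        - {\<phi> x, \<phi> y, \<phi> z}\<^bsub>H\<^esub> + \<phi> {x, y, z}\<^bsub>G\<^esub>) \<and>
      (\<forall>x a. c_mu C1 x a - c_mu C2 x a = [a, \<phi> x]\<^bsub>H\<^esub>) \<and>
      (\<forall>x y a. c_theta C1 x y a - c_theta C2 x y a =
        c_rho C2 x a (\<phi> y) - c_T C2 y a (\<phi> x) + {a, \<phi> x, \<phi> y}\<^bsub>H\<^esub>) \<and>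
      (\<forall>x y a. c_D C1 x y a - c_D C2 x y a =
        c_rho C2 y (\<phi> x) a - c_rho C2 x (\<phi> y) a + {\<phi> x, \<phi> y, a}\<^bsub>H\<^esub>) \<and>
      (\<forall>x a b. c_rho C1 x a b - c_rho C2 x a b = {a, \<phi> x, b}\<^bsub>H\<^esub>) \<and>
      (\<forall>x a b. c_T C1 x a b - c_T C2 x a b = {b, a, \<phi> x}\<^bsub>H\<^esub>))}"

definition H23_nab ::
  "('k::field, 'g::ab_group_add) ly_algebra \<Rightarrow> ('k, 'h::ab_group_add) ly_algebra \<Rightarrow>
    ('g, 'h) septuple set set"
  where "H23_nab G H = {C. is_cocycle G H C} // cocycle_equiv G H"

text \<open>
  The values computed in the middle term lie in the image of \<^verbatim>\<open>inc X\<close>; taking preimages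
  implements the identification of h with its image.
\<close>

definition induced_cocycle ::
  "('k::field, 'g::ab_group_add) ly_algebra \<Rightarrow> ('k, 'g, 'h::ab_group_add, 'e::ab_group_add) extension \<Rightarrow>
    ('g \<Rightarrow> 'e) \<Rightarrow> ('g, 'h) septuple"
  where "induced_cocycle G X s =
    \<lparr> c_chi = (\<lambda>x y. inv (inc X) ([s x, s y]\<^bsub>mid X\<^esub> - s [x, y]\<^bsub>G\<^esub>)),
      c_omega = (\<lambda>x y z. inv (inc X) ({s x, s y, s z}\<^bsub>mid X\<^esub> - s {x, y, z}\<^bsub>G\<^esub>)),
      c_mu = (\<lambda>x a. inv (inc X) [s x, inc X a]\<^bsub>mid X\<^esub>),
      c_theta = (\<lambda>x y a. inv (inc X) {inc X a, s x, s y}\<^bsub>mid X\<^esub>),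
      c_D = (\<lambda>x y a. inv (inc X) {s x, s y, inc X a}\<^bsub>mid X\<^esub>),
      c_rho = (\<lambda>x a b. inv (inc X) {s x, inc X a, inc X b}\<^bsub>mid X\<^esub>),
      c_T = (\<lambda>x a b. inv (inc X) {inc X a, inc X b, s x}\<^bsub>mid X\<^esub>) \<rparr>"


section \<open>The universe of extensions\<close>

text \<open>
  All extensions together form a proper class, so they are collected inside a type \<^verbatim>\<open>'e\<close>. The
  only restriction on it is that it carries some vector space structure into which the direct
  sum of the spaces g and h embeds linearly. As the middle term of every extension of g by h is
  isomorphic to this direct sum as a vector space, the restriction holds if and only if \<^verbatim>\<open>'e\<close>
  contains the middle term of some extension; in particular it holds for every vector space
  \<^verbatim>\<open>'e\<close> carrying a given extension, or a given pair of extensions as subspaces.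
\<close>

definition has_room_for_extensions ::
  "('k::field, 'g::ab_group_add) ly_algebra \<Rightarrow> ('k, 'h::ab_group_add) ly_algebra \<Rightarrow>
    'e::ab_group_add itself \<Rightarrow> bool"
  where "has_room_for_extensions G H U \<longleftrightarrow>
    (\<exists>(sm :: 'k \<Rightarrow> 'e \<Rightarrow> 'e) (j :: 'g \<times> 'h \<Rightarrow> 'e).
      Vector_Spaces.linear (\<lambda>c (x, a). (smult G c x, smult H c a)) sm j \<and> inj j)"

end

theory Submission
  imports Defs
begin

text \<open>
  A section \<^verbatim>\<open>s\<close> of an extension of \<^verbatim>\<open>g\<close> by \<^verbatim>\<open>h\<close> identifies the middle term with the vector space
  \<^verbatim>\<open>g \<times> h\<close>, by \<^verbatim>\<open>(x, a) \<mapsto> s x + a\<close>. Transported to \<^verbatim>\<open>g \<times> h\<close>, the two operations of the middle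
  term are given by explicit formulas in the seven maps of the induced septuple. For an arbitrary
  septuple \<^verbatim>\<open>C\<close> of multilinear maps these formulas define an algebra, the twisted product
  \<^verbatim>\<open>twist G H C\<close>. The proof rests on three facts about it.

  First, \<^verbatim>\<open>C\<close> is a non-abelian (2,3)-cocycle if and only if \<^verbatim>\<open>twist G H C\<close> is a Lie-Yamaguti algebra
  (\<^verbatim>\<open>is_cocycle_iff\<close>). Both operations are multilinear, so that each axiom has to be tested only on
  arguments from \<^verbatim>\<open>g \<times> 0\<close> and \<^verbatim>\<open>0 \<times> h\<close>. The tests with all arguments from \<^verbatim>\<open>0 \<times> h\<close> are the axioms
  of \<^verbatim>\<open>h\<close>. For (LY2) to (LY5) the other tests correspond, up to the symmetries of the axiom, one by
  one to the cocycle equations (ii) to (v). Those of (LY1) either are the equations (i) or hold by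
  the construction of the twisted product.

  Second, a linear map \<^verbatim>\<open>\<phi>\<close> realises an equivalence of the cocycles \<^verbatim>\<open>C1\<close> and \<^verbatim>\<open>C2\<close> if and only if the
  shear \<^verbatim>\<open>(x, a) \<mapsto> (x, a - \<phi> x)\<close> is a homomorphism from \<^verbatim>\<open>twist G H C1\<close> to \<^verbatim>\<open>twist G H C2\<close>
  (\<^verbatim>\<open>cocycle_equiv_iff\<close>). Shears compose by adding the maps \<^verbatim>\<open>\<phi>\<close>, which shows that equivalence of
  cocycles is an equivalence relation.

  Third, under the identification above the equivalences between two extensions with
  chosen sections become exactly the homomorphic shears between the twisted products. Hence
  two extensions are equivalent if and only if their induced cocycles are
  (\<^verbatim>\<open>extension_equiv_iff_cocycle_equiv\<close>). Applied to one extension with two sections, this shows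
  that the class of the induced cocycle does not depend on the section.

  The map on classes is therefore well defined and injective. It is surjective
  because the twisted product of a cocycle, copied into the ambient type along a linear
  injection of \<^verbatim>\<open>g \<times> h\<close>, is an extension whose obvious section induces the given cocycle
  (\<^verbatim>\<open>extension_of_cocycle\<close>).
\<close>

section \<open>Linear maps and Lie-Yamaguti algebras\<close>

text \<open>
  An equation between linear expressions often is an instance of another one up to sign and
  order of the terms. Comparing differences leaves an identity in a free abelian group.
\<close>

lemma eq_by_diff:
  fixes a b :: "'a::ab_group_add"
  assumes "c = d" and "a - b = c - d"
  shows "a = b"
  using assms by simp

lemma eq_by_diff_swap:
  fixes a b :: "'a::ab_group_add"
  assumes "c = d" and "a - b = d - c"
  shows "a = b"
  using assms by simp

text \<open>
  A single conjunction, which the simplifier splits into rewrite rules; in this form the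
  laws of all multilinear maps below are obtained by one instantiation each.
\<close>

lemma linear_map_UNIV:
  assumes "linear_map A B f" and "carrier A = UNIV"
  shows "(\<forall>x y. f (x + y) = f x + f y) \<and> (\<forall>c x. f (smult A c x) = smult B c (f x)) \<and>
    f 0 = 0 \<and> (\<forall>x. f (- x) = - f x) \<and> (\<forall>x y. f (x - y) = f x - f y)"
proof -
  interpret f: additive f
    using assms by unfold_locales (simp add: linear_map_def)
  show ?thesis
    using assms by (simp add: f.add f.zero f.minus f.diff) (simp add: linear_map_def)
qed

lemma linear_map_UNIV_I:
  assumes "\<And>x y. f (x + y) = f x + f y" and "\<And>c x. f (smult A c x) = smult B c (f x)"
    and "carrier B = UNIV"
  shows "linear_map A B f"
  using assms by (simp add: linear_map_def)

lemma lie_yamaguti_UNIV: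
  assumes "lie_yamaguti A" and U: "carrier A = UNIV"
  shows "linear_map A A (\<lambda>x. [x, y]\<^bsub>A\<^esub>)" and "linear_map A A (\<lambda>y. [x, y]\<^bsub>A\<^esub>)"
    and "linear_map A A (\<lambda>x. {x, y, z}\<^bsub>A\<^esub>)" and "linear_map A A (\<lambda>y. {x, y, z}\<^bsub>A\<^esub>)"
    and "linear_map A A (\<lambda>z. {x, y, z}\<^bsub>A\<^esub>)"
    and "[x, y]\<^bsub>A\<^esub> = - [y, x]\<^bsub>A\<^esub>" and "{x, y, z}\<^bsub>A\<^esub> = - {y, x, z}\<^bsub>A\<^esub>"
    and "[[x, y]\<^bsub>A\<^esub>, z]\<^bsub>A\<^esub> + [[y, z]\<^bsub>A\<^esub>, x]\<^bsub>A\<^esub> + [[z, x]\<^bsub>A\<^esub>, y]\<^bsub>A\<^esub>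
        + {x, y, z}\<^bsub>A\<^esub> + {y, z, x}\<^bsub>A\<^esub> + {z, x, y}\<^bsub>A\<^esub> = 0"
    and "{[x, y]\<^bsub>A\<^esub>, z, w}\<^bsub>A\<^esub> + {[y, z]\<^bsub>A\<^esub>, x, w}\<^bsub>A\<^esub> + {[z, x]\<^bsub>A\<^esub>, y, w}\<^bsub>A\<^esub> = 0"
    and "{x, y, [z, w]\<^bsub>A\<^esub>}\<^bsub>A\<^esub> = [{x, y, z}\<^bsub>A\<^esub>, w]\<^bsub>A\<^esub> + [z, {x, y, w}\<^bsub>A\<^esub>]\<^bsub>A\<^esub>"
    and "{x, y, {z, w, v}\<^bsub>A\<^esub>}\<^bsub>A\<^esub> =
          {{x, y, z}\<^bsub>A\<^esub>, w, v}\<^bsub>A\<^esub> + {z, {x, y, w}\<^bsub>A\<^esub>, v}\<^bsub>A\<^esub> + {z, w, {x, y, v}\<^bsub>A\<^esub>}\<^bsub>A\<^esub>"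
proof -
  interpret lie_yamaguti A by fact
  show "[x, y]\<^bsub>A\<^esub> = - [y, x]\<^bsub>A\<^esub>" "{x, y, z}\<^bsub>A\<^esub> = - {y, x, z}\<^bsub>A\<^esub>"
    using LY1[of x y] LY1(2)[of x y z] by (simp_all add: U eq_neg_iff_add_eq_0)
qed (rule lie_yamaguti.brk_linear lie_yamaguti.trp_linear lie_yamaguti.LY2 lie_yamaguti.LY3
      lie_yamaguti.LY4 lie_yamaguti.LY5; simp add: assms)+

lemma (in lie_yamaguti) closed:
  "0 \<in> carrier A"
  "x \<in> carrier A \<Longrightarrow> y \<in> carrier A \<Longrightarrow> x + y \<in> carrier A"
  "x \<in> carrier A \<Longrightarrow> y \<in> carrier A \<Longrightarrow> x - y \<in> carrier A"
  "x \<in> carrier A \<Longrightarrow> smult A c x \<in> carrier A"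
  "x \<in> carrier A \<Longrightarrow> y \<in> carrier A \<Longrightarrow> [x, y]\<^bsub>A\<^esub> \<in> carrier A"
  "x \<in> carrier A \<Longrightarrow> y \<in> carrier A \<Longrightarrow> z \<in> carrier A \<Longrightarrow> {x, y, z}\<^bsub>A\<^esub> \<in> carrier A"
  using subspace_carrier brk_linear(1)[of y] trp_linear(1)[of y z]
  by (auto simp: linear_map_def intro: subspace_0 subspace_add subspace_diff subspace_scale)

lemma ly_hom_comp:
  assumes "ly_hom A B f" and "ly_hom B M g"
  shows "ly_hom A M (\<lambda>x. g (f x))"
  using assms by (simp add: ly_hom_def linear_map_def)

text \<open>
  Only the left factor \<^verbatim>\<open>k\<close> has to be injective. With \<^verbatim>\<open>h\<close> the identity, this says that the inverse
  of a bijective homomorphism is a homomorphism.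
\<close>

lemma ly_hom_cancel_left:
  assumes B: "lie_yamaguti B" and h: "ly_hom A M h" and k: "ly_hom B M k"
    and inj: "inj_on k (carrier B)"
    and g: "\<And>x. x \<in> carrier A \<Longrightarrow> g x \<in> carrier B \<and> k (g x) = h x"
    and A: "lie_yamaguti A"
  shows "ly_hom A B g"
proof -
  interpret A: lie_yamaguti A by fact
  interpret B: lie_yamaguti B by fact
  have eqI: "x = y" if "k x = k y" "x \<in> carrier B" "y \<in> carrier B" for x y
    using inj that by (auto dest: inj_onD)
  show ?thesis
    using h k unfolding ly_hom_def linear_map_def
    by (auto simp: g A.closed B.closed intro!: eqI)
qed

text \<open>
  A subspace that is closed under the operations and embeds homomorphically into a Lie-Yamaguti
  algebra is a Lie-Yamaguti algebra: linearity and the axioms are equations, which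
  may be tested after applying the embedding.
\<close>

lemma ly_pullback:
  assumes B: "lie_yamaguti B" and vs: "vector_space (smult A)"
    and sub: "module.subspace (smult A) (carrier A)"
    and cl: "\<And>x y. x \<in> carrier A \<Longrightarrow> y \<in> carrier A \<Longrightarrow> [x, y]\<^bsub>A\<^esub> \<in> carrier A"
      "\<And>x y z. x \<in> carrier A \<Longrightarrow> y \<in> carrier A \<Longrightarrow> z \<in> carrier A \<Longrightarrow> {x, y, z}\<^bsub>A\<^esub> \<in> carrier A"
    and f: "ly_hom A B f" and inj: "inj_on f (carrier A)"
  shows "lie_yamaguti A"
proof -
  interpret B: lie_yamaguti B by fact
  interpret A: vector_space "smult A" by fact
  note [simp] = cl A.subspace_add[OF sub] A.subspace_scale[OF sub] A.subspace_0[OF sub]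
  have [simp]: "f x \<in> carrier B" if "x \<in> carrier A" for x
    using f that by (simp add: ly_hom_def linear_map_def)
  have [simp]: "f (x + y) = f x + f y" "f [x, y]\<^bsub>A\<^esub> = [f x, f y]\<^bsub>B\<^esub>"
    if "x \<in> carrier A" "y \<in> carrier A" for x y
    using f that by (simp_all add: ly_hom_def linear_map_def)
  have [simp]: "f (smult A c x) = smult B c (f x)" if "x \<in> carrier A" for x c
    using f that by (simp_all add: ly_hom_def linear_map_def)
  have [simp]: "f {x, y, z}\<^bsub>A\<^esub> = {f x, f y, f z}\<^bsub>B\<^esub>"
    if "x \<in> carrier A" "y \<in> carrier A" "z \<in> carrier A" for x y z
    using f that by (simp_all add: ly_hom_def)
  have "f 0 + f 0 = f (0 + 0)"
    by (simp del: add_0_left add_0_right)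
  then have [simp]: "f 0 = 0"
    by simp
  have eqI: "x = y" if "f x = f y" "x \<in> carrier A" "y \<in> carrier A" for x y
    using inj that by (auto dest: inj_onD)
  have lin: "linear_map A A g"
    if "linear_map B B g'" "\<And>x. x \<in> carrier A \<Longrightarrow> g x \<in> carrier A \<and> f (g x) = g' (f x)" for g g'
    unfolding linear_map_def
    using that(1) by (auto simp: that(2) linear_map_def intro!: eqI)
  show ?thesis
  proof
    show "A.subspace (carrier A)" by fact
  next
    fix x1 x2 y1 y2 y3
    assume [simp]: "x1 \<in> carrier A" "x2 \<in> carrier A"
    show "linear_map A A (\<lambda>x. [x, x1]\<^bsub>A\<^esub>)"
      by (rule lin[OF B.brk_linear(1)[of "f x1"]]) simp_all
    show "linear_map A A (\<lambda>x. [x1, x]\<^bsub>A\<^esub>)"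
      by (rule lin[OF B.brk_linear(2)[of "f x1"]]) simp_all
    show "linear_map A A (\<lambda>x. {x, x1, x2}\<^bsub>A\<^esub>)"
      by (rule lin[OF B.trp_linear(1)[of "f x1" "f x2"]]) simp_all
    show "linear_map A A (\<lambda>x. {x1, x, x2}\<^bsub>A\<^esub>)"
      by (rule lin[OF B.trp_linear(2)[of "f x1" "f x2"]]) simp_all
    show "linear_map A A (\<lambda>x. {x1, x2, x}\<^bsub>A\<^esub>)"
      by (rule lin[OF B.trp_linear(3)[of "f x1" "f x2"]]) simp_all
    show "[x1, x2]\<^bsub>A\<^esub> + [x2, x1]\<^bsub>A\<^esub> = 0"
      by (rule eqI) (simp_all add: B.LY1)
    assume [simp]: "y1 \<in> carrier A"
    show "{x1, x2, y1}\<^bsub>A\<^esub> + {x2, x1, y1}\<^bsub>A\<^esub> = 0"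
      by (rule eqI) (simp_all add: B.LY1)
    show "[[x1, x2]\<^bsub>A\<^esub>, y1]\<^bsub>A\<^esub> + [[x2, y1]\<^bsub>A\<^esub>, x1]\<^bsub>A\<^esub> + [[y1, x1]\<^bsub>A\<^esub>, x2]\<^bsub>A\<^esub>
        + {x1, x2, y1}\<^bsub>A\<^esub> + {x2, y1, x1}\<^bsub>A\<^esub> + {y1, x1, x2}\<^bsub>A\<^esub> = 0"
      by (rule eqI) (simp_all add: B.LY2)
    assume [simp]: "y2 \<in> carrier A"
    show "{[x1, x2]\<^bsub>A\<^esub>, y1, y2}\<^bsub>A\<^esub> + {[x2, y1]\<^bsub>A\<^esub>, x1, y2}\<^bsub>A\<^esub> + {[y1, x1]\<^bsub>A\<^esub>, x2, y2}\<^bsub>A\<^esub> = 0"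
      by (rule eqI) (simp_all add: B.LY3)
    show "{x1, x2, [y1, y2]\<^bsub>A\<^esub>}\<^bsub>A\<^esub> = [{x1, x2, y1}\<^bsub>A\<^esub>, y2]\<^bsub>A\<^esub> + [y1, {x1, x2, y2}\<^bsub>A\<^esub>]\<^bsub>A\<^esub>"
      by (rule eqI; simp; rule B.LY4; simp)
    assume [simp]: "y3 \<in> carrier A"
    show "{x1, x2, {y1, y2, y3}\<^bsub>A\<^esub>}\<^bsub>A\<^esub> =
          {{x1, x2, y1}\<^bsub>A\<^esub>, y2, y3}\<^bsub>A\<^esub> + {y1, {x1, x2, y2}\<^bsub>A\<^esub>, y3}\<^bsub>A\<^esub>
          + {y1, y2, {x1, x2, y3}\<^bsub>A\<^esub>}\<^bsub>A\<^esub>"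
      by (rule eqI; simp; rule B.LY5; simp)
  qed
qed

text \<open>
  The defects of the axioms (LY2) to (LY5): each axiom says that the respective expression
  vanishes. They are additive in every argument when the operations are.
\<close>

definition defect2 :: "('k::field, 'a::ab_group_add) ly_algebra \<Rightarrow> 'a \<Rightarrow> 'a \<Rightarrow> 'a \<Rightarrow> 'a"
  where "defect2 A x y z = [[x, y]\<^bsub>A\<^esub>, z]\<^bsub>A\<^esub> + [[y, z]\<^bsub>A\<^esub>, x]\<^bsub>A\<^esub> + [[z, x]\<^bsub>A\<^esub>, y]\<^bsub>A\<^esub>
    + {x, y, z}\<^bsub>A\<^esub> + {y, z, x}\<^bsub>A\<^esub> + {z, x, y}\<^bsub>A\<^esub>"

definition defect3 :: "('k::field, 'a::ab_group_add) ly_algebra \<Rightarrow> 'a \<Rightarrow> 'a \<Rightarrow> 'a \<Rightarrow> 'a \<Rightarrow> 'a"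
  where "defect3 A x y z w =
    {[x, y]\<^bsub>A\<^esub>, z, w}\<^bsub>A\<^esub> + {[y, z]\<^bsub>A\<^esub>, x, w}\<^bsub>A\<^esub> + {[z, x]\<^bsub>A\<^esub>, y, w}\<^bsub>A\<^esub>"

definition defect4 :: "('k::field, 'a::ab_group_add) ly_algebra \<Rightarrow> 'a \<Rightarrow> 'a \<Rightarrow> 'a \<Rightarrow> 'a \<Rightarrow> 'a"
  where "defect4 A x y z w =
    {x, y, [z, w]\<^bsub>A\<^esub>}\<^bsub>A\<^esub> - ([{x, y, z}\<^bsub>A\<^esub>, w]\<^bsub>A\<^esub> + [z, {x, y, w}\<^bsub>A\<^esub>]\<^bsub>A\<^esub>)"

definition defect5 :: "('k::field, 'a::ab_group_add) ly_algebra \<Rightarrow> 'a \<Rightarrow> 'a \<Rightarrow> 'a \<Rightarrow> 'a \<Rightarrow> 'a \<Rightarrow> 'a"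
  where "defect5 A x y z w v = {x, y, {z, w, v}\<^bsub>A\<^esub>}\<^bsub>A\<^esub> -
    ({{x, y, z}\<^bsub>A\<^esub>, w, v}\<^bsub>A\<^esub> + {z, {x, y, w}\<^bsub>A\<^esub>, v}\<^bsub>A\<^esub> + {z, w, {x, y, v}\<^bsub>A\<^esub>}\<^bsub>A\<^esub>)"

lemmas defect_defs = defect2_def defect3_def defect4_def defect5_def

lemma lie_yamaguti_UNIV_I:
  assumes "vector_space (smult A)" and U: "carrier A = UNIV"
    and "\<And>x y. linear_map A A (\<lambda>x. [x, y]\<^bsub>A\<^esub>)" "\<And>x y. linear_map A A (\<lambda>y. [x, y]\<^bsub>A\<^esub>)"
    and "\<And>x y z. linear_map A A (\<lambda>x. {x, y, z}\<^bsub>A\<^esub>)" "\<And>x y z. linear_map A A (\<lambda>y. {x, y, z}\<^bsub>A\<^esub>)"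
      "\<And>x y z. linear_map A A (\<lambda>z. {x, y, z}\<^bsub>A\<^esub>)"
    and "\<And>x y. [x, y]\<^bsub>A\<^esub> + [y, x]\<^bsub>A\<^esub> = 0" "\<And>x y z. {x, y, z}\<^bsub>A\<^esub> + {y, x, z}\<^bsub>A\<^esub> = 0"
    and "\<And>x y z. defect2 A x y z = 0" "\<And>x y z w. defect3 A x y z w = 0"
      "\<And>x y z w. defect4 A x y z w = 0" "\<And>x y z w v. defect5 A x y z w v = 0"
  shows "lie_yamaguti A"
proof -
  interpret vector_space "smult A" by fact
  note defects = assms(10-)[unfolded defect_defs right_minus_eq]
  show ?thesis
    by unfold_locales (simp add: U, (rule assms defects)+)
qed

section \<open>Twisted products\<close>

text \<open>
  The operations on \<^verbatim>\<open>g \<times> h\<close> that a septuple defines. They arise by expanding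
  \<^verbatim>\<open>[s x + a, s y + b]\<close> and \<^verbatim>\<open>{s x + a, s y + b, s z + c}\<close> in an extension with section \<^verbatim>\<open>s\<close>; the minus
  signs come from exchanging the first two arguments where the induced septuple uses them in the
  opposite order.
\<close>

definition twist ::
  "('k::field, 'g::ab_group_add) ly_algebra \<Rightarrow> ('k, 'h::ab_group_add) ly_algebra \<Rightarrow>
    ('g, 'h) septuple \<Rightarrow> ('k, 'g \<times> 'h) ly_algebra"
  where "twist G H C =
    \<lparr> smult = (\<lambda>c (x, a). (smult G c x, smult H c a)),
      carrier = UNIV,
      brk = (\<lambda>(x, a) (y, b).
        ([x, y]\<^bsub>G\<^esub>, c_chi C x y + c_mu C x b - c_mu C y a + [a, b]\<^bsub>H\<^esub>)),
      trp = (\<lambda>(x, a) (y, b) (z, c).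
        ({x, y, z}\<^bsub>G\<^esub>,
         c_omega C x y z + c_theta C y z a - c_theta C x z b + c_D C x y c
         + c_T C z a b + c_rho C x b c - c_rho C y a c + {a, b, c}\<^bsub>H\<^esub>)) \<rparr>"

lemma twist_simps [simp]:
  "smult (twist G H C) r (x, a) = (smult G r x, smult H r a)"
  "carrier (twist G H C) = UNIV"
  "[(x, a), (y, b)]\<^bsub>twist G H C\<^esub> =
    ([x, y]\<^bsub>G\<^esub>, c_chi C x y + c_mu C x b - c_mu C y a + [a, b]\<^bsub>H\<^esub>)"
  "{(x, a), (y, b), (z, c)}\<^bsub>twist G H C\<^esub> =
    ({x, y, z}\<^bsub>G\<^esub>,
     c_omega C x y z + c_theta C y z a - c_theta C x z b + c_D C x y c
     + c_T C z a b + c_rho C x b c - c_rho C y a c + {a, b, c}\<^bsub>H\<^esub>)"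
  by (simp_all add: twist_def)

text \<open>
  The two algebras \<^verbatim>\<open>g\<close> and \<^verbatim>\<open>h\<close>, each with a whole type as its carrier.
\<close>

locale ly_pair =
  fixes G :: "('k::field, 'g::ab_group_add) ly_algebra"
    and H :: "('k, 'h::ab_group_add) ly_algebra"
  assumes G: "lie_yamaguti G" and G_UNIV [simp]: "carrier G = UNIV"
    and H: "lie_yamaguti H" and H_UNIV [simp]: "carrier H = UNIV"
begin

sublocale G: lie_yamaguti G by (rule G)
sublocale H: lie_yamaguti H by (rule H)

lemmas G_LY = lie_yamaguti_UNIV(6-)[OF G G_UNIV]
lemmas H_LY = lie_yamaguti_UNIV(6-)[OF H H_UNIV]
lemmas G_lin = lie_yamaguti_UNIV(1-5)[OF G G_UNIV, THEN linear_map_UNIV, OF G_UNIV]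
lemmas H_lin = lie_yamaguti_UNIV(1-5)[OF H H_UNIV, THEN linear_map_UNIV, OF H_UNIV]

lemma vector_space_twist: "vector_space (smult (twist G H C))"
  by unfold_locales (auto simp: G.scale_right_distrib G.scale_left_distrib
      H.scale_right_distrib H.scale_left_distrib)

end

text \<open>
  A septuple subject only to the multilinearity part of the definition of a cocycle.
\<close>

locale multilinear_septuple = ly_pair G H
  for G :: "('k::field, 'g::ab_group_add) ly_algebra"
    and H :: "('k, 'h::ab_group_add) ly_algebra" +
  fixes C :: "('g, 'h) septuple"
  assumes chi_linear:
      "linear_map G H (\<lambda>x. c_chi C x y)"
      "linear_map G H (\<lambda>y. c_chi C x y)"
    and omega_linear:
      "linear_map G H (\<lambda>x. c_omega C x y z)"
      "linear_map G H (\<lambda>y. c_omega C x y z)"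
      "linear_map G H (\<lambda>z. c_omega C x y z)"
    and mu_linear:
      "linear_map G H (\<lambda>x. c_mu C x a)"
      "linear_map H H (\<lambda>a. c_mu C x a)"
    and theta_linear:
      "linear_map G H (\<lambda>x. c_theta C x y a)"
      "linear_map G H (\<lambda>y. c_theta C x y a)"
      "linear_map H H (\<lambda>a. c_theta C x y a)"
    and D_linear:
      "linear_map G H (\<lambda>x. c_D C x y a)"
      "linear_map G H (\<lambda>y. c_D C x y a)"
      "linear_map H H (\<lambda>a. c_D C x y a)"
    and rho_linear:
      "linear_map G H (\<lambda>x. c_rho C x a b)"
      "linear_map H H (\<lambda>a. c_rho C x a b)"
      "linear_map H H (\<lambda>b. c_rho C x a b)"
    and T_linear:
      "linear_map G H (\<lambda>x. c_T C x a b)"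
      "linear_map H H (\<lambda>a. c_T C x a b)"
      "linear_map H H (\<lambda>b. c_T C x a b)"
begin

lemmas C_lin =
  chi_linear[THEN linear_map_UNIV, OF G_UNIV]
  omega_linear[THEN linear_map_UNIV, OF G_UNIV]
  mu_linear(1)[THEN linear_map_UNIV, OF G_UNIV] mu_linear(2)[THEN linear_map_UNIV, OF H_UNIV]
  theta_linear(1,2)[THEN linear_map_UNIV, OF G_UNIV] theta_linear(3)[THEN linear_map_UNIV, OF H_UNIV]
  D_linear(1,2)[THEN linear_map_UNIV, OF G_UNIV] D_linear(3)[THEN linear_map_UNIV, OF H_UNIV]
  rho_linear(1)[THEN linear_map_UNIV, OF G_UNIV] rho_linear(2,3)[THEN linear_map_UNIV, OF H_UNIV]
  T_linear(1)[THEN linear_map_UNIV, OF G_UNIV] T_linear(2,3)[THEN linear_map_UNIV, OF H_UNIV]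

lemmas lin = G_lin H_lin C_lin

abbreviation E :: "('k, 'g \<times> 'h) ly_algebra" where "E \<equiv> twist G H C"

lemma twist_add:
  "[u + u', v]\<^bsub>E\<^esub> = [u, v]\<^bsub>E\<^esub> + [u', v]\<^bsub>E\<^esub>" "[v, u + u']\<^bsub>E\<^esub> = [v, u]\<^bsub>E\<^esub> + [v, u']\<^bsub>E\<^esub>"
  "{u + u', v, w}\<^bsub>E\<^esub> = {u, v, w}\<^bsub>E\<^esub> + {u', v, w}\<^bsub>E\<^esub>"
  "{v, u + u', w}\<^bsub>E\<^esub> = {v, u, w}\<^bsub>E\<^esub> + {v, u', w}\<^bsub>E\<^esub>"
  "{v, w, u + u'}\<^bsub>E\<^esub> = {v, w, u}\<^bsub>E\<^esub> + {v, w, u'}\<^bsub>E\<^esub>"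
  by (cases u; cases u'; cases v; cases w; simp add: lin algebra_simps)+

lemma twist_scale:
  "[smult E c u, v]\<^bsub>E\<^esub> = smult E c [u, v]\<^bsub>E\<^esub>" "[v, smult E c u]\<^bsub>E\<^esub> = smult E c [v, u]\<^bsub>E\<^esub>"
  "{smult E c u, v, w}\<^bsub>E\<^esub> = smult E c {u, v, w}\<^bsub>E\<^esub>"
  "{v, smult E c u, w}\<^bsub>E\<^esub> = smult E c {v, u, w}\<^bsub>E\<^esub>"
  "{v, w, smult E c u}\<^bsub>E\<^esub> = smult E c {v, w, u}\<^bsub>E\<^esub>"
  by (cases u; cases v; cases w;
      simp add: lin H.scale_right_distrib H.scale_right_diff_distrib)+

lemma twist_linear:
  "linear_map E E (\<lambda>u. [u, v]\<^bsub>E\<^esub>)" "linear_map E E (\<lambda>u. [v, u]\<^bsub>E\<^esub>)"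
  "linear_map E E (\<lambda>u. {u, v, w}\<^bsub>E\<^esub>)" "linear_map E E (\<lambda>u. {v, u, w}\<^bsub>E\<^esub>)"
  "linear_map E E (\<lambda>u. {v, w, u}\<^bsub>E\<^esub>)"
  by (simp_all add: linear_map_def twist_add twist_scale)

lemmas twist_lin = twist_linear[THEN linear_map_UNIV, OF twist_simps(2)]

section \<open>Cocycles and the axioms of the twisted product\<close>

text \<open>
  The cocycle equations are the \<^verbatim>\<open>h\<close>-components of the axioms on pure vectors \<^verbatim>\<open>(x, 0)\<close> and
  \<^verbatim>\<open>(0, a)\<close>, up to sign and to moving terms across.
\<close>

lemma is_cocycle_if_lie_yamaguti:
  assumes E: "lie_yamaguti E"
  shows "is_cocycle G H C"
proof -
  note E_LY = lie_yamaguti_UNIV(6-)[OF E twist_simps(2)]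
  have d: "defect2 E u v w = 0" "defect3 E u v w r = 0"
      "defect4 E u v w r = 0" "defect5 E u v w r q = 0"
    for u v w r q
    unfolding defect_defs right_minus_eq by (rule E_LY)+
  note LY2 = arg_cong[where f = snd, OF d(1)] and LY3 = arg_cong[where f = snd, OF d(2)]
    and LY4 = arg_cong[where f = snd, OF d(3)] and LY5 = arg_cong[where f = snd, OF d(4)]
  have chi_skew: "c_chi C x y = - c_chi C y x" for x y
    using E_LY(1)[of "(x, 0)" "(y, 0)"] by (simp add: lin)
  have omega_skew: "c_omega C x y z = - c_omega C y x z" for x y z
    using E_LY(2)[of "(x, 0)" "(y, 0)" "(z, 0)"] by (simp add: lin)
  have D_skew: "c_D C x y a = - c_D C y x a" for x y a
    using E_LY(2)[of "(x, 0)" "(y, 0)" "(0, a)"] by (simp add: lin)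
  have T_skew: "c_T C x a b = - c_T C x b a" for x a b
    using E_LY(2)[of "(0, a)" "(0, b)" "(x, 0)"] by (simp add: lin)
  note simps = defect_defs lin algebra_simps
  \<comment> \<open>The rules for T_skew, H_LY(1) and H_LY(2) are instantiated because as general rewrite rules
    they do not terminate.\<close>
  show ?thesis
    unfolding is_cocycle_def
    apply (rule nonabelian_cocycle.intro)
    apply (rule chi_linear omega_linear mu_linear theta_linear D_linear rho_linear T_linear)+
    subgoal for x y by (simp add: chi_skew[of x y])
    subgoal for x y by (simp add: omega_skew[of x y])
    subgoal for x y by (simp add: D_skew[of x y])
    subgoal for x a b by (simp add: T_skew[of x a b])
    subgoal for x y z
      by (rule eq_by_diff[OF LY2[of "(x, 0)" "(y, 0)" "(z, 0)"]]) (simp add: simps)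
    subgoal for x y a
      by (rule eq_by_diff[OF LY2[of "(x, 0)" "(y, 0)" "(0, a)"]]) (simp add: simps)
    subgoal for x a b
      by (rule eq_by_diff[OF LY2[of "(x, 0)" "(0, a)" "(0, b)"]]) (simp add: simps)
    subgoal for x y z w
      by (rule eq_by_diff[OF LY3[of "(x, 0)" "(y, 0)" "(z, 0)" "(w, 0)"]]) (simp add: simps)
    subgoal for x y z a
      by (rule eq_by_diff[OF LY3[of "(x, 0)" "(y, 0)" "(z, 0)" "(0, a)"]]) (simp add: simps)
    subgoal for x y z a
      by (rule eq_by_diff_swap[OF LY3[of "(x, 0)" "(y, 0)" "(0, a)" "(z, 0)"]]) (simp add: simps)
    subgoal for x y a b
      by (rule eq_by_diff[OF LY3[of "(x, 0)" "(y, 0)" "(0, a)" "(0, b)"]]) (simp add: simps)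
    subgoal for y x a b
      by (rule eq_by_diff[OF LY3[of "(x, 0)" "(0, a)" "(0, b)" "(y, 0)"]]) (simp add: simps)
    subgoal for x a b c
      by (rule eq_by_diff[OF LY3[of "(x, 0)" "(0, a)" "(0, b)" "(0, c)"]]) (simp add: simps)
    subgoal for x a b c
      by (rule eq_by_diff[OF LY3[of "(0, a)" "(0, b)" "(0, c)" "(x, 0)"]]) (simp add: simps)
    subgoal for x y z w
      by (rule eq_by_diff[OF LY4[of "(x, 0)" "(y, 0)" "(z, 0)" "(w, 0)"]]) (simp add: simps)
    subgoal for x y z a
      by (rule eq_by_diff[OF LY4[of "(x, 0)" "(y, 0)" "(z, 0)" "(0, a)"]]) (simp add: simps)
    subgoal for x y z a
      by (rule eq_by_diff_swap[OF LY4[of "(x, 0)" "(0, a)" "(y, 0)" "(z, 0)"]]) (simp add: simps)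
    subgoal for x y a b
      by (rule eq_by_diff[OF LY4[of "(x, 0)" "(y, 0)" "(0, a)" "(0, b)"]]) (simp add: simps)
    subgoal for x a y b
      by (rule eq_by_diff[OF LY4[of "(x, 0)" "(0, a)" "(y, 0)" "(0, b)"]]) (simp add: simps)
    subgoal for x y a b
      by (rule eq_by_diff[OF LY4[of "(0, a)" "(0, b)" "(x, 0)" "(y, 0)"]]) (simp add: simps)
    subgoal for a b x c
      by (rule eq_by_diff[OF LY4[of "(0, a)" "(0, b)" "(x, 0)" "(0, c)"]])
        (simp add: simps H_LY(1)[of "c_T C x a b" c])
    subgoal for x a b c
      by (rule eq_by_diff[OF LY4[of "(x, 0)" "(0, a)" "(0, b)" "(0, c)"]]) (simp add: simps)
    subgoal for x y z w v
      by (rule eq_by_diff[OF LY5[of "(x, 0)" "(y, 0)" "(z, 0)" "(w, 0)" "(v, 0)"]])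
        (simp add: simps)
    subgoal for x y z w a
      by (rule eq_by_diff[OF LY5[of "(x, 0)" "(y, 0)" "(0, a)" "(z, 0)" "(w, 0)"]])
        (simp add: simps T_skew[of w a "c_omega C x y z"])
    subgoal for x y z w a
      by (rule eq_by_diff_swap[OF LY5[of "(x, 0)" "(0, a)" "(y, 0)" "(z, 0)" "(w, 0)"]])
        (simp add: simps)
    subgoal for x y z w a
      by (rule eq_by_diff[OF LY5[of "(x, 0)" "(y, 0)" "(z, 0)" "(w, 0)" "(0, a)"]])
        (simp add: simps)
    subgoal for x y z a b
      by (rule eq_by_diff[OF LY5[of "(x, 0)" "(y, 0)" "(z, 0)" "(0, a)" "(0, b)"]])
        (simp add: simps)
    subgoal for y z x a b
      by (rule eq_by_diff_swap[OF LY5[of "(x, 0)" "(0, a)" "(y, 0)" "(z, 0)" "(0, b)"]])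
        (simp add: simps)
    subgoal for y z x a b
      by (rule eq_by_diff_swap[OF LY5[of "(x, 0)" "(0, a)" "(0, b)" "(y, 0)" "(z, 0)"]])
        (simp add: simps T_skew[of z b "c_theta C x y a"])
    subgoal for x y z a b
      by (rule eq_by_diff[OF LY5[of "(x, 0)" "(y, 0)" "(0, a)" "(0, b)" "(z, 0)"]])
        (simp add: simps)
    subgoal for x y z a b
      by (rule eq_by_diff[OF LY5[of "(0, a)" "(0, b)" "(x, 0)" "(y, 0)" "(z, 0)"]])
        (simp add: simps)
    subgoal for x y a b c
      by (rule eq_by_diff[OF LY5[of "(x, 0)" "(y, 0)" "(0, a)" "(0, b)" "(0, c)"]])
        (simp add: simps)
    subgoal for x a y b c
      by (rule eq_by_diff[OF LY5[of "(x, 0)" "(0, a)" "(y, 0)" "(0, b)" "(0, c)"]])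
        (simp add: simps)
    subgoal for a b x y c
      by (rule eq_by_diff[OF LY5[of "(0, a)" "(0, b)" "(0, c)" "(x, 0)" "(y, 0)"]])
        (simp add: simps T_skew[of y c "c_T C x a b"])
    subgoal for x a y b c
      by (rule eq_by_diff[OF LY5[of "(x, 0)" "(0, a)" "(0, b)" "(0, c)" "(y, 0)"]])
        (simp add: simps)
    subgoal for a b x y c
      by (rule eq_by_diff[OF LY5[of "(0, a)" "(0, b)" "(x, 0)" "(y, 0)" "(0, c)"]])
        (simp add: simps)
    subgoal for a b x c d
      by (rule eq_by_diff[OF LY5[of "(0, a)" "(0, b)" "(x, 0)" "(0, c)" "(0, d)"]])
        (simp add: simps H_LY(2)[of "c_T C x a b" c d])
    subgoal for x a b c d
      by (rule eq_by_diff[OF LY5[of "(x, 0)" "(0, a)" "(0, b)" "(0, c)" "(0, d)"]])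
        (simp add: simps)
    subgoal for a b x c d
      by (rule eq_by_diff[OF LY5[of "(0, a)" "(0, b)" "(0, c)" "(0, d)" "(x, 0)"]])
        (simp add: simps)
    done
qed

text \<open>
  Conversely, the cocycle equations make the defects vanish on pure vectors of one order in each
  orbit of the symmetries: cyclic rotation for (LY2) and (LY3), transposition of the first two or
  of the next two arguments for (LY4) and (LY5). Additivity then gives the general case.
\<close>

lemma lie_yamaguti_if_is_cocycle:
  assumes "is_cocycle G H C"
  shows "lie_yamaguti E"
proof -
  interpret nonabelian_cocycle G H "c_chi C" "c_omega C" "c_mu C" "c_theta C" "c_D C" "c_rho C" "c_T C"
    using assms by (simp add: is_cocycle_def)
  have T_skew: "c_T C x a b = - c_T C x b a" for x a b
    using cocycle_i(4)[of x a b] by (simp add: eq_neg_iff_add_eq_0)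
  note simps = defect_defs lin algebra_simps
  have brk_skew0: "[u, v]\<^bsub>E\<^esub> + [v, u]\<^bsub>E\<^esub> = 0" for u v
    using H.LY1(1) G.LY1(1) cocycle_i
    by (cases u; cases v) (simp add: algebra_simps zero_prod_def)
  have trp_skew0: "{u, v, w}\<^bsub>E\<^esub> + {v, u, w}\<^bsub>E\<^esub> = 0" for u v w
    using H.LY1(2) G.LY1(2) cocycle_i
    by (cases u; cases v; cases w) (simp add: algebra_simps zero_prod_def)
  have brk_skew: "[u, v]\<^bsub>E\<^esub> = - [v, u]\<^bsub>E\<^esub>" for u v
    using brk_skew0 by (simp add: eq_neg_iff_add_eq_0)
  have trp_skew: "{u, v, w}\<^bsub>E\<^esub> = - {v, u, w}\<^bsub>E\<^esub>" for u v w
    using trp_skew0 by (simp add: eq_neg_iff_add_eq_0)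
  have pure2:
    "defect2 E (x, 0) (y, 0) (z, 0) = 0"
    "defect2 E (x, 0) (y, 0) (0, a) = 0"
    "defect2 E (x, 0) (0, a) (0, b) = 0"
    "defect2 E (0, a) (0, b) (0, c) = 0"
    for x y z :: 'g and a b c :: 'h
    subgoal
      by (rule prod_eqI, simp add: defect2_def G_lin G_LY(3)[of x y z],
          rule eq_by_diff[OF cocycle_ii(1)[where x = x and y = y and z = z]],
          simp add: simps)
    subgoal
      by (rule prod_eqI, simp add: defect2_def G_lin,
          rule eq_by_diff[OF cocycle_ii(2)[where x = x and y = y and a = a]],
          simp add: simps)
    subgoal
      by (rule prod_eqI, simp add: defect2_def G_lin,
          rule eq_by_diff[OF cocycle_ii(3)[where x = x and a = a and b = b]],
          simp add: simps)
    subgoal by (simp add: defect2_def lin zero_prod_def H_LY(3)[of a b c])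
    done
  have pure3:
    "defect3 E (x, 0) (y, 0) (z, 0) (w, 0) = 0"
    "defect3 E (x, 0) (y, 0) (z, 0) (0, a) = 0"
    "defect3 E (x, 0) (y, 0) (0, a) (z, 0) = 0"
    "defect3 E (x, 0) (y, 0) (0, a) (0, b) = 0"
    "defect3 E (x, 0) (0, a) (0, b) (y, 0) = 0"
    "defect3 E (x, 0) (0, a) (0, b) (0, c) = 0"
    "defect3 E (0, a) (0, b) (0, c) (x, 0) = 0"
    "defect3 E (0, a) (0, b) (0, c) (0, d) = 0"
    for x y z w :: 'g and a b c d :: 'h
    subgoal
      by (rule prod_eqI, simp add: defect3_def G_lin G_LY(4)[of x y z w],
          rule eq_by_diff[OF cocycle_iii(1)[where x = x and y = y and z = z and w = w]],
          simp add: simps)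
    subgoal
      by (rule prod_eqI, simp add: defect3_def G_lin,
          rule eq_by_diff[OF cocycle_iii(2)[where x = x and y = y and z = z and a = a]],
          simp add: simps)
    subgoal
      by (rule prod_eqI, simp add: defect3_def G_lin,
          rule eq_by_diff_swap[OF cocycle_iii(3)[where x = x and y = y and z = z and a = a]],
          simp add: simps)
    subgoal
      by (rule prod_eqI, simp add: defect3_def G_lin,
          rule eq_by_diff[OF cocycle_iii(4)[where x = x and y = y and a = a and b = b]],
          simp add: simps)
    subgoal
      by (rule prod_eqI, simp add: defect3_def G_lin,
          rule eq_by_diff[OF cocycle_iii(5)[where y = y and x = x and a = a and b = b]],
          simp add: simps)
    subgoal
      by (rule prod_eqI, simp add: defect3_def G_lin,
          rule eq_by_diff[OF cocycle_iii(6)[where x = x and a = a and b = b and c = c]],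
          simp add: simps)
    subgoal
      by (rule prod_eqI, simp add: defect3_def G_lin,
          rule eq_by_diff[OF cocycle_iii(7)[where x = x and a = a and b = b and c = c]],
          simp add: simps)
    subgoal by (simp add: defect3_def lin zero_prod_def H_LY(4)[of a b c d])
    done
  have pure4:
    "defect4 E (x, 0) (y, 0) (z, 0) (w, 0) = 0"
    "defect4 E (x, 0) (y, 0) (z, 0) (0, a) = 0"
    "defect4 E (x, 0) (0, a) (y, 0) (z, 0) = 0"
    "defect4 E (x, 0) (y, 0) (0, a) (0, b) = 0"
    "defect4 E (x, 0) (0, a) (y, 0) (0, b) = 0"
    "defect4 E (0, a) (0, b) (x, 0) (y, 0) = 0"
    "defect4 E (0, a) (0, b) (x, 0) (0, c) = 0"
    "defect4 E (x, 0) (0, a) (0, b) (0, c) = 0"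
    "defect4 E (0, a) (0, b) (0, c) (0, d) = 0"
    for x y z w :: 'g and a b c d :: 'h
    subgoal
      by (rule prod_eqI, simp add: defect4_def G_lin G_LY(5)[of x y z w],
          rule eq_by_diff[OF cocycle_iv(1)[where x = x and y = y and z = z and w = w]],
          simp add: simps)
    subgoal
      by (rule prod_eqI, simp add: defect4_def G_lin,
          rule eq_by_diff[OF cocycle_iv(2)[where x = x and y = y and z = z and a = a]],
          simp add: simps)
    subgoal
      by (rule prod_eqI, simp add: defect4_def G_lin,
          rule eq_by_diff_swap[OF cocycle_iv(3)[where x = x and y = y and z = z and a = a]],
          simp add: simps)
    subgoal
      by (rule prod_eqI, simp add: defect4_def G_lin,
          rule eq_by_diff[OF cocycle_iv(4)[where x = x and y = y and a = a and b = b]],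
          simp add: simps)
    subgoal
      by (rule prod_eqI, simp add: defect4_def G_lin,
          rule eq_by_diff[OF cocycle_iv(5)[where x = x and a = a and y = y and b = b]],
          simp add: simps)
    subgoal
      by (rule prod_eqI, simp add: defect4_def G_lin,
          rule eq_by_diff[OF cocycle_iv(6)[where x = x and y = y and a = a and b = b]],
          simp add: simps)
    subgoal
      by (rule prod_eqI, simp add: defect4_def G_lin,
          rule eq_by_diff[OF cocycle_iv(7)[where a = a and b = b and x = x and c = c]],
          simp add: simps H_LY(1)[of "c_T C x a b" c])
    subgoal
      by (rule prod_eqI, simp add: defect4_def G_lin,
          rule eq_by_diff[OF cocycle_iv(8)[where x = x and a = a and b = b and c = c]],
          simp add: simps)
    subgoal by (simp add: defect4_def lin zero_prod_def H_LY(5)[of a b c d])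
    done
  have pure5:
    "defect5 E (x, 0) (y, 0) (z, 0) (w, 0) (v, 0) = 0"
    "defect5 E (x, 0) (y, 0) (0, a) (z, 0) (w, 0) = 0"
    "defect5 E (x, 0) (0, a) (y, 0) (z, 0) (w, 0) = 0"
    "defect5 E (x, 0) (y, 0) (z, 0) (w, 0) (0, a) = 0"
    "defect5 E (x, 0) (y, 0) (z, 0) (0, a) (0, b) = 0"
    "defect5 E (x, 0) (0, a) (y, 0) (z, 0) (0, b) = 0"
    "defect5 E (x, 0) (0, a) (0, b) (y, 0) (z, 0) = 0"
    "defect5 E (x, 0) (y, 0) (0, a) (0, b) (z, 0) = 0"
    "defect5 E (0, a) (0, b) (x, 0) (y, 0) (z, 0) = 0"
    "defect5 E (x, 0) (y, 0) (0, a) (0, b) (0, c) = 0"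
    "defect5 E (x, 0) (0, a) (y, 0) (0, b) (0, c) = 0"
    "defect5 E (0, a) (0, b) (0, c) (x, 0) (y, 0) = 0"
    "defect5 E (x, 0) (0, a) (0, b) (0, c) (y, 0) = 0"
    "defect5 E (0, a) (0, b) (x, 0) (y, 0) (0, c) = 0"
    "defect5 E (0, a) (0, b) (x, 0) (0, c) (0, d) = 0"
    "defect5 E (x, 0) (0, a) (0, b) (0, c) (0, d) = 0"
    "defect5 E (0, a) (0, b) (0, c) (0, d) (x, 0) = 0"
    "defect5 E (0, a) (0, b) (0, c) (0, d) (0, e) = 0"
    for x y z w v :: 'g and a b c d e :: 'h
    subgoal
      by (rule prod_eqI, simp add: defect5_def G_lin G_LY(6)[of x y z w v],
          rule eq_by_diff[OF cocycle_v(1)[of x y z w v]],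
          simp add: simps)
    subgoal
      by (rule prod_eqI, simp add: defect5_def G_lin,
          rule eq_by_diff[OF cocycle_v(2)[where x = x and y = y and z = z and w = w and a = a]],
          simp add: simps T_skew[of w a "c_omega C x y z"])
    subgoal
      by (rule prod_eqI, simp add: defect5_def G_lin,
          rule eq_by_diff_swap[OF cocycle_v(3)[where x = x and y = y and z = z and w = w and a = a]],
          simp add: simps)
    subgoal
      by (rule prod_eqI, simp add: defect5_def G_lin,
          rule eq_by_diff[OF cocycle_v(4)[where x = x and y = y and z = z and w = w and a = a]],
          simp add: simps)
    subgoal
      by (rule prod_eqI, simp add: defect5_def G_lin,
          rule eq_by_diff[OF cocycle_v(5)[where x = x and y = y and z = z and a = a and b = b]],
          simp add: simps)
    subgoal
      by (rule prod_eqI, simp add: defect5_def G_lin,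
          rule eq_by_diff_swap[OF cocycle_v(6)[where y = y and z = z and x = x and a = a and b = b]],
          simp add: simps)
    subgoal
      by (rule prod_eqI, simp add: defect5_def G_lin,
          rule eq_by_diff_swap[OF cocycle_v(7)[where y = y and z = z and x = x and a = a and b = b]],
          simp add: simps T_skew[of z b "c_theta C x y a"])
    subgoal
      by (rule prod_eqI, simp add: defect5_def G_lin,
          rule eq_by_diff[OF cocycle_v(8)[where x = x and y = y and z = z and a = a and b = b]],
          simp add: simps)
    subgoal
      by (rule prod_eqI, simp add: defect5_def G_lin,
          rule eq_by_diff[OF cocycle_v(9)[where x = x and y = y and z = z and a = a and b = b]],
          simp add: simps)
    subgoal
      by (rule prod_eqI, simp add: defect5_def G_lin,
          rule eq_by_diff[OF cocycle_v(10)[where x = x and y = y and a = a and b = b and c = c]],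
          simp add: simps)
    subgoal
      by (rule prod_eqI, simp add: defect5_def G_lin,
          rule eq_by_diff[OF cocycle_v(11)[where x = x and a = a and y = y and b = b and c = c]],
          simp add: simps)
    subgoal
      by (rule prod_eqI, simp add: defect5_def G_lin,
          rule eq_by_diff[OF cocycle_v(12)[where a = a and b = b and x = x and y = y and c = c]],
          simp add: simps T_skew[of y c "c_T C x a b"])
    subgoal
      by (rule prod_eqI, simp add: defect5_def G_lin,
          rule eq_by_diff[OF cocycle_v(13)[where x = x and a = a and y = y and b = b and c = c]],
          simp add: simps)
    subgoal
      by (rule prod_eqI, simp add: defect5_def G_lin,
          rule eq_by_diff[OF cocycle_v(14)[where a = a and b = b and x = x and y = y and c = c]],
          simp add: simps)
    subgoal
      by (rule prod_eqI, simp add: defect5_def G_lin,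
          rule eq_by_diff[OF cocycle_v(15)[where a = a and b = b and x = x and c = c and d = d]],
          simp add: simps H_LY(2)[of "c_T C x a b" c d])
    subgoal
      by (rule prod_eqI, simp add: defect5_def G_lin,
          rule eq_by_diff[OF cocycle_v(16)[where x = x and a = a and b = b and c = c and d = d]],
          simp add: simps)
    subgoal
      by (rule prod_eqI, simp add: defect5_def G_lin,
          rule eq_by_diff[OF cocycle_v(17)[where a = a and b = b and x = x and c = c and d = d]],
          simp add: simps)
    subgoal by (simp add: defect5_def lin zero_prod_def H_LY(6)[of a b c d e])
    done
  note add = twist_add algebra_simps
  have add2: "defect2 E (u + u') v w = defect2 E u v w + defect2 E u' v w"
      "defect2 E v (u + u') w = defect2 E v u w + defect2 E v u' w"
      "defect2 E v w (u + u') = defect2 E v w u + defect2 E v w u'"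
    for u u' v w
    by (simp_all add: defect2_def add)
  have add3: "defect3 E (u + u') v w r = defect3 E u v w r + defect3 E u' v w r"
      "defect3 E v (u + u') w r = defect3 E v u w r + defect3 E v u' w r"
      "defect3 E v w (u + u') r = defect3 E v w u r + defect3 E v w u' r"
      "defect3 E v w r (u + u') = defect3 E v w r u + defect3 E v w r u'"
    for u u' v w r
    by (simp_all add: defect3_def add)
  have add4: "defect4 E (u + u') v w r = defect4 E u v w r + defect4 E u' v w r"
      "defect4 E v (u + u') w r = defect4 E v u w r + defect4 E v u' w r"
      "defect4 E v w (u + u') r = defect4 E v w u r + defect4 E v w u' r"
      "defect4 E v w r (u + u') = defect4 E v w r u + defect4 E v w r u'"
    for u u' v w r
    by (simp_all add: defect4_def add)
  have add5: "defect5 E (u + u') v w r q = defect5 E u v w r q + defect5 E u' v w r q"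
      "defect5 E v (u + u') w r q = defect5 E v u w r q + defect5 E v u' w r q"
      "defect5 E v w (u + u') r q = defect5 E v w u r q + defect5 E v w u' r q"
      "defect5 E v w r (u + u') q = defect5 E v w r u q + defect5 E v w r u' q"
      "defect5 E v w r q (u + u') = defect5 E v w r q u + defect5 E v w r q u'"
    for u u' v w r q
    by (simp_all add: defect5_def add)
  have rot2: "defect2 E u v w = defect2 E v w u" for u v w
    by (simp add: defect2_def algebra_simps)
  have rot3: "defect3 E u v w r = defect3 E v w u r" for u v w r
    by (simp add: defect3_def algebra_simps)
  have swap4: "defect4 E u v w r = - defect4 E v u w r" "defect4 E u v w r = - defect4 E u v r w"
    for u v w r
    by (simp_all add: defect4_def twist_lin trp_skew[of u v] brk_skew[of w r]
        brk_skew[of "{u, v, w}\<^bsub>E\<^esub>" r] brk_skew[of "{u, v, r}\<^bsub>E\<^esub>" w]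
        brk_skew[of "{v, u, w}\<^bsub>E\<^esub>" r] brk_skew[of "{v, u, r}\<^bsub>E\<^esub>" w])
  have swap5: "defect5 E u v w r q = - defect5 E v u w r q"
      "defect5 E u v w r q = - defect5 E u v r w q"
    for u v w r q
    by (simp_all add: defect5_def twist_lin trp_skew[of u v] trp_skew[of w r]
        trp_skew[of "{u, v, w}\<^bsub>E\<^esub>" r] trp_skew[of "{u, v, r}\<^bsub>E\<^esub>" w]
        trp_skew[of "{v, u, w}\<^bsub>E\<^esub>" r] trp_skew[of "{v, u, r}\<^bsub>E\<^esub>" w])
  show ?thesis
  proof (rule lie_yamaguti_UNIV_I)
    show "vector_space (smult E)"
      by (rule vector_space_twist)
    fix u v w r q :: "'g \<times> 'h"
    show "[u, v]\<^bsub>E\<^esub> + [v, u]\<^bsub>E\<^esub> = 0" "{u, v, w}\<^bsub>E\<^esub> + {v, u, w}\<^bsub>E\<^esub> = 0"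
      by (rule brk_skew0 trp_skew0)+
    \<comment> \<open>After splitting all arguments, the symmetries bring every summand into one of the
      orders covered by the vanishing on pure vectors.\<close>
    obtain x1 x2 x3 x4 x5 :: 'g and a1 a2 a3 a4 a5 :: 'h where split:
        "u = (x1, 0) + (0, a1)" "v = (x2, 0) + (0, a2)" "w = (x3, 0) + (0, a3)"
        "r = (x4, 0) + (0, a4)" "q = (x5, 0) + (0, a5)"
      by (cases u; cases v; cases w; cases r; cases q) simp
    have "defect2 E (0, a) (x, 0) v = defect2 E (x, 0) v (0, a)"
         "defect2 E (x, 0) (0, a) (y, 0) = defect2 E (y, 0) (x, 0) (0, a)"
         "defect2 E (0, a) (0, b) (x, 0) = defect2 E (x, 0) (0, a) (0, b)" for x y a b v
      by (metis rot2)+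
    then show "defect2 E u v w = 0"
      by (simp only: split add2 pure2 minus_zero add_0_left)
    have "defect3 E (0, a) (x, 0) v r = defect3 E (x, 0) v (0, a) r"
         "defect3 E (x, 0) (0, a) (y, 0) r = defect3 E (y, 0) (x, 0) (0, a) r"
         "defect3 E (0, a) (0, b) (x, 0) r = defect3 E (x, 0) (0, a) (0, b) r" for x y a b v r
      by (metis rot3)+
    then show "defect3 E u v w r = 0"
      by (simp only: split add3 pure3 minus_zero add_0_left)
    show "defect4 E u v w r = 0"
      by (simp only: split add4 pure4 swap4(1)[of "(0, a)" "(x, 0)" for a x]
          swap4(2)[of _ _ "(0, a)" "(x, 0)" for a x] minus_zero add_0_left)
    show "defect5 E u v w r q = 0"
      by (simp only: split add5 pure5 swap5(1)[of "(0, a)" "(x, 0)" for a x]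
          swap5(2)[of _ _ "(0, a)" "(x, 0)" "(0, b)" for a x b]
          swap5(2)[of _ _ "(x, 0)" "(0, a)" "(y, 0)" for x a y] minus_zero add_0_left)
  qed (simp_all add: twist_linear)
qed

end

context ly_pair
begin

lemma multilinear_if_is_cocycle:
  assumes "is_cocycle G H C"
  shows "multilinear_septuple G H C"
proof -
  interpret nonabelian_cocycle G H "c_chi C" "c_omega C" "c_mu C" "c_theta C" "c_D C" "c_rho C" "c_T C"
    using assms by (simp add: is_cocycle_def)
  show ?thesis
    by unfold_locales
      (rule chi_linear omega_linear mu_linear theta_linear D_linear rho_linear T_linear)+
qed

lemma is_cocycle_iff:
  "is_cocycle G H C \<longleftrightarrow> multilinear_septuple G H C \<and> lie_yamaguti (twist G H C)"
  using multilinear_if_is_cocycle multilinear_septuple.is_cocycle_if_lie_yamaguti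
    multilinear_septuple.lie_yamaguti_if_is_cocycle by blast

end

section \<open>Equivalence of cocycles and shears\<close>

text \<open>
  The change of coordinates on \<^verbatim>\<open>g \<times> h\<close> between two sections related by \<^verbatim>\<open>s1 = s2 - \<phi>\<close>: the vector
  \<^verbatim>\<open>s1 x + a\<close> equals \<^verbatim>\<open>s2 x + (a - \<phi> x)\<close>.
\<close>

definition shear :: "('g \<Rightarrow> 'h::ab_group_add) \<Rightarrow> 'g \<times> 'h \<Rightarrow> 'g \<times> 'h"
  where "shear \<phi> = (\<lambda>(x, a). (x, a - \<phi> x))"

lemma shear_simps [simp]: "shear \<phi> (x, a) = (x, a - \<phi> x)"
  by (simp add: shear_def)

lemma fst_shear [simp]: "fst (shear \<phi> u) = fst u"
  by (simp add: shear_def split_beta)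

context ly_pair
begin

text \<open>
  The seven equations between equivalent cocycles express that the shear preserves the operations.
  They are its homomorphism property on pure vectors \<^verbatim>\<open>(x, 0)\<close> and \<^verbatim>\<open>(0, a)\<close>; conversely they allow to
  rewrite the operations of the first twisted product in terms of the second septuple.
\<close>

lemma cocycle_equiv_iff:
  "(C1, C2) \<in> cocycle_equiv G H \<longleftrightarrow> is_cocycle G H C1 \<and> is_cocycle G H C2 \<and>
    (\<exists>\<phi>. linear_map G H \<phi> \<and> ly_hom (twist G H C1) (twist G H C2) (shear \<phi>))"
proof -
  have "ly_hom (twist G H C1) (twist G H C2) (shear \<phi>) \<longleftrightarrow>
      (\<forall>x y. c_chi C1 x y - c_chi C2 x y =
        [\<phi> x, \<phi> y]\<^bsub>H\<^esub> + \<phi> [x, y]\<^bsub>G\<^esub> - c_mu C2 x (\<phi> y) + c_mu C2 y (\<phi> x)) \<and>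
      (\<forall>x y z. c_omega C1 x y z - c_omega C2 x y z =
        c_theta C2 x z (\<phi> y) - c_D C2 x y (\<phi> z) + c_rho C2 x (\<phi> y) (\<phi> z)
        - c_theta C2 y z (\<phi> x) + c_T C2 z (\<phi> x) (\<phi> y) - c_rho C2 y (\<phi> x) (\<phi> z)
        - {\<phi> x, \<phi> y, \<phi> z}\<^bsub>H\<^esub> + \<phi> {x, y, z}\<^bsub>G\<^esub>) \<and>
      (\<forall>x a. c_mu C1 x a - c_mu C2 x a = [a, \<phi> x]\<^bsub>H\<^esub>) \<and>
      (\<forall>x y a. c_theta C1 x y a - c_theta C2 x y a =
        c_rho C2 x a (\<phi> y) - c_T C2 y a (\<phi> x) + {a, \<phi> x, \<phi> y}\<^bsub>H\<^esub>) \<and>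
      (\<forall>x y a. c_D C1 x y a - c_D C2 x y a =
        c_rho C2 y (\<phi> x) a - c_rho C2 x (\<phi> y) a + {\<phi> x, \<phi> y, a}\<^bsub>H\<^esub>) \<and>
      (\<forall>x a b. c_rho C1 x a b - c_rho C2 x a b = {a, \<phi> x, b}\<^bsub>H\<^esub>) \<and>
      (\<forall>x a b. c_T C1 x a b - c_T C2 x a b = {b, a, \<phi> x}\<^bsub>H\<^esub>)"
    (is "?hom \<longleftrightarrow> ?conds")
    if C1: "is_cocycle G H C1" and C2: "is_cocycle G H C2" and phi: "linear_map G H \<phi>" for \<phi>
  proof -
    interpret C1: multilinear_septuple G H C1
      using C1 by (rule multilinear_if_is_cocycle)
    interpret C2: multilinear_septuple G H C2
      using C2 by (rule multilinear_if_is_cocycle)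
    note phi_lin = linear_map_UNIV[OF phi G_UNIV]
    note lin = G_lin H_lin C1.C_lin C2.C_lin phi_lin
    have T_skew: "c_T C2 x a b = - c_T C2 x b a" for x a b
      using C2 by (simp add: is_cocycle_def nonabelian_cocycle.cocycle_i(4) eq_neg_iff_add_eq_0)
    show ?thesis
    proof
      assume hom: ?hom
      have brk: "snd (shear \<phi> [u, v]\<^bsub>twist G H C1\<^esub>) = snd [shear \<phi> u, shear \<phi> v]\<^bsub>twist G H C2\<^esub>" for u v
        using hom unfolding ly_hom_def by (metis UNIV_I twist_simps(2))
      have trp: "snd (shear \<phi> {u, v, w}\<^bsub>twist G H C1\<^esub>) =
          snd {shear \<phi> u, shear \<phi> v, shear \<phi> w}\<^bsub>twist G H C2\<^esub>" for u v w
        using hom unfolding ly_hom_def by (metis UNIV_I twist_simps(2))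
      show ?conds
        apply (intro conjI allI)
        subgoal for x y
          by (rule eq_by_diff[OF brk[of "(x, 0)" "(y, 0)"]]) (simp add: lin algebra_simps)
        subgoal for x y z
          by (rule eq_by_diff[OF trp[of "(x, 0)" "(y, 0)" "(z, 0)"]]) (simp add: lin algebra_simps)
        subgoal for x a
          by (rule eq_by_diff[OF brk[of "(x, 0)" "(0, a)"]])
            (simp add: lin H_LY(1)[of a] algebra_simps)
        subgoal for x y a
          by (rule eq_by_diff[OF trp[of "(0, a)" "(x, 0)" "(y, 0)"]]) (simp add: lin algebra_simps)
        subgoal for x y a
          by (rule eq_by_diff[OF trp[of "(x, 0)" "(y, 0)" "(0, a)"]]) (simp add: lin algebra_simps)
        subgoal for x a b
          by (rule eq_by_diff[OF trp[of "(x, 0)" "(0, a)" "(0, b)"]])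
            (simp add: lin H_LY(2)[of a "\<phi> x"] algebra_simps)
        subgoal for x a b
          by (rule eq_by_diff[OF trp[of "(0, a)" "(0, b)" "(x, 0)"]])
            (simp add: lin H_LY(2)[of b a] algebra_simps)
        done
    next
      assume conds: ?conds
      note C1_eq = conds[unfolded diff_eq_eq]
      have "shear \<phi> [u, v]\<^bsub>twist G H C1\<^esub> = [shear \<phi> u, shear \<phi> v]\<^bsub>twist G H C2\<^esub>" for u v
      proof (cases u; cases v)
        fix x y a b assume "u = (x, a)" "v = (y, b)"
        then show ?thesis
          by (simp add: C1_eq lin H_LY(1)[of b "\<phi> x"] algebra_simps)
      qed
      moreover have "shear \<phi> {u, v, w}\<^bsub>twist G H C1\<^esub> =
          {shear \<phi> u, shear \<phi> v, shear \<phi> w}\<^bsub>twist G H C2\<^esub>" for u v w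
      proof (cases u; cases v; cases w)
        fix x y z a b c assume "u = (x, a)" "v = (y, b)" "w = (z, c)"
        then show ?thesis
          by (simp add: C1_eq lin H_LY(2)[of b "\<phi> x"] H_LY(2)[of b a "\<phi> z"]
              T_skew[of z b "\<phi> x"] algebra_simps)
      qed
      moreover have "linear_map (twist G H C1) (twist G H C2) (shear \<phi>)"
        by (rule linear_map_UNIV_I) (auto simp: lin H.scale_right_diff_distrib)
      ultimately show ?hom
        by (simp add: ly_hom_def)
    qed
  qed
  note key = this
  show ?thesis
    unfolding cocycle_equiv_def mem_Collect_eq case_prod_conv
    by (intro conj_cong ex_cong1 refl) (rule key[symmetric])
qed

lemma equiv_cocycle_equiv: "equiv {C. is_cocycle G H C} (cocycle_equiv G H)"
proof (rule equivI)
  let ?E = "\<lambda>C. twist G H C"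
  show "cocycle_equiv G H \<subseteq> {C. is_cocycle G H C} \<times> {C. is_cocycle G H C}"
    by (auto simp: cocycle_equiv_iff)
  show "refl_on {C. is_cocycle G H C} (cocycle_equiv G H)"
  proof (rule refl_onI)
    fix C assume "C \<in> {C. is_cocycle G H C}"
    moreover have "ly_hom (?E C) (?E C) (shear (\<lambda>_. 0))"
      by (auto simp: ly_hom_def linear_map_def)
    moreover have "linear_map G H (\<lambda>_. 0)"
      by (simp add: linear_map_def)
    ultimately show "(C, C) \<in> cocycle_equiv G H"
      unfolding cocycle_equiv_iff by blast
  qed
  show "sym (cocycle_equiv G H)"
  proof (rule symI)
    fix C1 C2 assume "(C1, C2) \<in> cocycle_equiv G H"
    then obtain \<phi> where C: "is_cocycle G H C1" "is_cocycle G H C2"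
      and phi: "linear_map G H \<phi>" "ly_hom (?E C1) (?E C2) (shear \<phi>)"
      by (auto simp: cocycle_equiv_iff)
    have "ly_hom (?E C2) (?E C1) (shear (\<lambda>x. - \<phi> x))"
    proof (rule ly_hom_cancel_left)
      show "ly_hom (?E C1) (?E C2) (shear \<phi>)" by fact
      show "ly_hom (?E C2) (?E C2) (\<lambda>x. x)"
        by (simp add: ly_hom_def linear_map_def)
      show "inj_on (shear \<phi>) (carrier (?E C1))"
        by (auto simp: inj_on_def)
    qed (use C in \<open>auto simp: is_cocycle_iff\<close>)
    moreover have "linear_map G H (\<lambda>x. - \<phi> x)"
      using phi(1) by (auto simp: linear_map_def)
    ultimately show "(C2, C1) \<in> cocycle_equiv G H"
      unfolding cocycle_equiv_iff using C by blast
  qed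
  show "trans (cocycle_equiv G H)"
  proof (rule transI)
    fix C1 C2 C3 assume "(C1, C2) \<in> cocycle_equiv G H" "(C2, C3) \<in> cocycle_equiv G H"
    then obtain \<phi> \<psi> where C: "is_cocycle G H C1" "is_cocycle G H C3"
      and phi: "linear_map G H \<phi>" "ly_hom (?E C1) (?E C2) (shear \<phi>)"
      and psi: "linear_map G H \<psi>" "ly_hom (?E C2) (?E C3) (shear \<psi>)"
      by (auto simp: cocycle_equiv_iff)
    have "(\<lambda>u. shear \<psi> (shear \<phi> u)) = shear (\<lambda>x. \<phi> x + \<psi> x)"
      by (auto simp: fun_eq_iff)
    with ly_hom_comp[OF phi(2) psi(2)]
    have "ly_hom (?E C1) (?E C3) (shear (\<lambda>x. \<phi> x + \<psi> x))"
      by simp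
    moreover have "linear_map G H (\<lambda>x. \<phi> x + \<psi> x)"
      using phi(1) psi(1) by (auto simp: linear_map_def H.scale_right_distrib)
    ultimately show "(C1, C3) \<in> cocycle_equiv G H"
      unfolding cocycle_equiv_iff using C by blast
  qed
qed

end

section \<open>Extensions with a section\<close>

context ly_pair
begin

text \<open>
  A basis of \<^verbatim>\<open>g\<close> is lifted to the carrier of the middle term and the lift is extended linearly. Its
  values stay in the carrier, because the image of the extension is the span of the lifted basis;
  this matters since the projection is linear only there.
\<close>

lemma section_exists:
  fixes X :: "('k, 'g, 'h, 'e::ab_group_add) extension"
  assumes X: "is_extension G H X"
  shows "\<exists>s. is_section G X s"
proof -
  interpret M: lie_yamaguti "mid X"
    using X by (simp add: is_extension_def)
  interpret vector_space_pair "smult G" "smult (mid X)" ..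
  obtain B where B: "G.independent B" "G.span B = UNIV"
    by (metis G.maximal_independent_subset[of UNIV] top.extremum_uniqueI)
  have surj: "prj X ` carrier (mid X) = UNIV" and p: "linear_map (mid X) G (prj X)"
    using X by (simp_all add: is_extension_def ly_hom_def)
  define r where "r x = (SOME e. e \<in> carrier (mid X) \<and> prj X e = x)" for x
  have r: "r x \<in> carrier (mid X) \<and> prj X (r x) = x" for x
    unfolding r_def
  proof (rule someI_ex)
    have "x \<in> prj X ` carrier (mid X)"
      by (simp add: surj)
    then show "\<exists>e. e \<in> carrier (mid X) \<and> prj X e = x"
      by blast
  qed
  obtain s where s: "Vector_Spaces.linear (smult G) (smult (mid X)) s"
    "\<forall>x\<in>B. s x = r x" "range s = M.span (r ` B)"
    using linear_independent_extend_subspace[OF B(1)] by metis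
  interpret s: Vector_Spaces.linear "smult G" "smult (mid X)" s by fact
  have mem: "s x \<in> carrier (mid X)" for x
    using s(3) M.span_minimal[OF _ M.subspace_carrier, of "r ` B"] r by blast
  have "prj X (s x) = x" for x
  proof -
    have "x \<in> G.span B"
      using B by simp
    then show ?thesis
    proof (induction rule: G.span_induct_alt)
      case base
      have "prj X (0 + 0) = prj X 0 + prj X 0"
        using p M.subspace_0[OF M.subspace_carrier] unfolding linear_map_def by blast
      then show ?case
        by (simp add: s.zero)
    next
      case (step c x y)
      then show ?case
        using p mem r s(2) M.subspace_scale[OF M.subspace_carrier]
        by (simp add: linear_map_def s.add s.scale)
    qed
  qed
  with mem have "is_section G X s"
    by (simp add: is_section_def linear_map_def s.add s.scale)
  then show ?thesis
    by blast
qed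

end

text \<open>
  An extension together with a section. The context provides the arithmetic of the middle
  term \<^verbatim>\<open>M\<close> and the induced septuple \<^verbatim>\<open>C\<close>.
\<close>

locale split_extension = ly_pair G H
  for G :: "('k::field, 'g::ab_group_add) ly_algebra"
    and H :: "('k, 'h::ab_group_add) ly_algebra" +
  fixes X :: "('k, 'g, 'h, 'e::ab_group_add) extension" and s :: "'g \<Rightarrow> 'e"
  assumes ext: "is_extension G H X" and sec: "is_section G X s"
begin

abbreviation M where "M \<equiv> mid X"
abbreviation i where "i \<equiv> inc X"
abbreviation p where "p \<equiv> prj X"
abbreviation C where "C \<equiv> induced_cocycle G X s"

sublocale M: lie_yamaguti M
  using ext by (simp add: is_extension_def)

lemma mem [simp]: "i a \<in> carrier M" "s x \<in> carrier M"
  using ext sec by (simp_all add: is_extension_def is_section_def ly_hom_def linear_map_def)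

declare M.closed [simp]

lemma i_hom: "ly_hom H M i" and p_hom: "ly_hom M G p" and s_lin: "linear_map G M s"
  using ext sec by (simp_all add: is_extension_def is_section_def)

lemma i_simps:
  "i (a + b) = i a + i b" "i (smult H c a) = smult M c (i a)" "i 0 = 0" "i (- a) = - i a"
  "i (a - b) = i a - i b" "i [a, b]\<^bsub>H\<^esub> = [i a, i b]\<^bsub>M\<^esub>" "i {a, b, d}\<^bsub>H\<^esub> = {i a, i b, i d}\<^bsub>M\<^esub>"
  using i_hom linear_map_UNIV[of H M i] by (simp_all add: ly_hom_def)

lemma s_simps:
  "s (x + y) = s x + s y" "s (smult G c x) = smult M c (s x)" "s 0 = 0" "s (x - y) = s x - s y"
  using linear_map_UNIV[OF s_lin] by simp_all

lemma p_add: "u \<in> carrier M \<Longrightarrow> v \<in> carrier M \<Longrightarrow> p (u + v) = p u + p v"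
  using p_hom by (simp add: ly_hom_def linear_map_def)

lemma p_diff: "u \<in> carrier M \<Longrightarrow> v \<in> carrier M \<Longrightarrow> p (u - v) = p u - p v"
  using p_add[of "u - v" v] by simp

lemma p_brk: "u \<in> carrier M \<Longrightarrow> v \<in> carrier M \<Longrightarrow> p [u, v]\<^bsub>M\<^esub> = [p u, p v]\<^bsub>G\<^esub>"
  and p_trp: "u \<in> carrier M \<Longrightarrow> v \<in> carrier M \<Longrightarrow> w \<in> carrier M \<Longrightarrow>
    p {u, v, w}\<^bsub>M\<^esub> = {p u, p v, p w}\<^bsub>G\<^esub>"
  using p_hom by (simp_all add: ly_hom_def)

lemma ps [simp]: "p (s x) = x"
  using sec by (simp add: is_section_def)

lemma kernel: "range i = {e \<in> carrier M. p e = 0}" and inj_i: "inj i"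
  using ext by (simp_all add: is_extension_def)

lemma pi [simp]: "p (i a) = 0"
  using kernel by blast

lemma i_inv: "e \<in> carrier M \<Longrightarrow> p e = 0 \<Longrightarrow> i (inv i e) = e"
  using kernel by (intro f_inv_into_f) blast

lemma M_add:
  assumes "u \<in> carrier M" "u' \<in> carrier M" "v \<in> carrier M"
  shows "[u + u', v]\<^bsub>M\<^esub> = [u, v]\<^bsub>M\<^esub> + [u', v]\<^bsub>M\<^esub>" "[v, u + u']\<^bsub>M\<^esub> = [v, u]\<^bsub>M\<^esub> + [v, u']\<^bsub>M\<^esub>"
    "w \<in> carrier M \<Longrightarrow> {u + u', v, w}\<^bsub>M\<^esub> = {u, v, w}\<^bsub>M\<^esub> + {u', v, w}\<^bsub>M\<^esub>"
    "w \<in> carrier M \<Longrightarrow> {v, u + u', w}\<^bsub>M\<^esub> = {v, u, w}\<^bsub>M\<^esub> + {v, u', w}\<^bsub>M\<^esub>"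
    "w \<in> carrier M \<Longrightarrow> {v, w, u + u'}\<^bsub>M\<^esub> = {v, w, u}\<^bsub>M\<^esub> + {v, w, u'}\<^bsub>M\<^esub>"
  using M.brk_linear[of v] M.trp_linear(1,2)[of v w] M.trp_linear(3)[of v w] assms
  by (auto simp: linear_map_def)

lemma M_scale:
  assumes "u \<in> carrier M" "v \<in> carrier M"
  shows "[smult M c u, v]\<^bsub>M\<^esub> = smult M c [u, v]\<^bsub>M\<^esub>" "[v, smult M c u]\<^bsub>M\<^esub> = smult M c [v, u]\<^bsub>M\<^esub>"
    "w \<in> carrier M \<Longrightarrow> {smult M c u, v, w}\<^bsub>M\<^esub> = smult M c {u, v, w}\<^bsub>M\<^esub>"
    "w \<in> carrier M \<Longrightarrow> {v, smult M c u, w}\<^bsub>M\<^esub> = smult M c {v, u, w}\<^bsub>M\<^esub>"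
    "w \<in> carrier M \<Longrightarrow> {v, w, smult M c u}\<^bsub>M\<^esub> = smult M c {v, w, u}\<^bsub>M\<^esub>"
  using M.brk_linear[of v] M.trp_linear(1,2)[of v w] M.trp_linear(3)[of v w] assms
  by (auto simp: linear_map_def)

lemma M_skew:
  assumes "u \<in> carrier M" "v \<in> carrier M"
  shows "[u, v]\<^bsub>M\<^esub> = - [v, u]\<^bsub>M\<^esub>" "w \<in> carrier M \<Longrightarrow> {u, v, w}\<^bsub>M\<^esub> = - {v, u, w}\<^bsub>M\<^esub>"
  using M.LY1 assms by (simp_all add: eq_neg_iff_add_eq_0)

text \<open>
  The arguments of \<^verbatim>\<open>inv i\<close> in the induced septuple are killed by the projection, hence lie in the
  image of \<^verbatim>\<open>i\<close>.
\<close>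

lemma i_induced:
  "i (c_chi C x y) = [s x, s y]\<^bsub>M\<^esub> - s [x, y]\<^bsub>G\<^esub>"
  "i (c_omega C x y z) = {s x, s y, s z}\<^bsub>M\<^esub> - s {x, y, z}\<^bsub>G\<^esub>"
  "i (c_mu C x a) = [s x, i a]\<^bsub>M\<^esub>"
  "i (c_theta C x y a) = {i a, s x, s y}\<^bsub>M\<^esub>"
  "i (c_D C x y a) = {s x, s y, i a}\<^bsub>M\<^esub>"
  "i (c_rho C x a b) = {s x, i a, i b}\<^bsub>M\<^esub>"
  "i (c_T C x a b) = {i a, i b, s x}\<^bsub>M\<^esub>"
  by (simp_all add: induced_cocycle_def i_inv p_diff p_brk p_trp G_lin)

sublocale C: multilinear_septuple G H C
proof -
  have lin: "linear_map A H g"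
    if "\<And>x y. i (g (x + y)) = i (g x) + i (g y)" "\<And>c x. i (g (smult A c x)) = smult M c (i (g x))"
    for A :: "('k, 'x::ab_group_add) ly_algebra" and g
    using that by (intro linear_map_UNIV_I) (auto intro: injD[OF inj_i] simp: i_simps)
  show "multilinear_septuple G H C"
    by unfold_locales
      (rule lin;
       simp add: i_induced i_simps s_simps M_add M_scale G_lin M.scale_right_diff_distrib algebra_simps)+
qed

text \<open>
  The linear isomorphism from \<^verbatim>\<open>g \<times> h\<close> to the middle term that the section defines.
\<close>

definition j :: "'g \<times> 'h \<Rightarrow> 'e"
  where "j = (\<lambda>(x, a). s x + i a)"

lemma j_simps [simp]: "j (x, a) = s x + i a"
  by (simp add: j_def)

lemma p_j: "p (j u) = fst u"
  by (cases u) (simp add: p_add)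

lemma j_mem: "j u \<in> carrier M"
  by (cases u) simp

lemma inj_j: "inj j"
proof (rule injI)
  fix u v assume *: "j u = j v"
  then have "fst u = fst v"
    by (metis p_j)
  with * show "u = v"
    by (cases u; cases v) (auto dest: injD[OF inj_i])
qed

lemma bij_j: "bij_betw j UNIV (carrier M)"
proof (rule bij_betw_imageI[OF inj_j])
  have "e \<in> range j" if "e \<in> carrier M" for e
  proof
    show "e = j (p e, inv i (e - s (p e)))"
      using that by (simp add: i_inv p_diff)
  qed simp
  then show "range j = carrier M"
    using j_mem by blast
qed

lemma j_hom: "ly_hom (twist G H C) M j"
proof -
  have "linear_map (twist G H C) M j"
    by (auto simp: linear_map_def s_simps i_simps M.scale_right_distrib)
  moreover have "j [u, v]\<^bsub>twist G H C\<^esub> = [j u, j v]\<^bsub>M\<^esub>" for u v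
  proof (cases u; cases v)
    fix x y a b assume "u = (x, a)" "v = (y, b)"
    then show ?thesis
      by (simp add: i_simps i_induced M_add M_skew(1)[of "i a" "s y"])
  qed
  moreover have "j {u, v, w}\<^bsub>twist G H C\<^esub> = {j u, j v, j w}\<^bsub>M\<^esub>" for u v w
  proof (cases u; cases v; cases w)
    fix x y z a b c assume "u = (x, a)" "v = (y, b)" "w = (z, c)"
    then show ?thesis
      by (simp add: i_simps i_induced M_add M_skew(2)[of "i a" "s y"] M_skew(2)[of "s x" "i b" "s z"])
  qed
  ultimately show ?thesis
    by (simp add: ly_hom_def)
qed

lemma lie_yamaguti_twist: "lie_yamaguti (twist G H C)"
proof (rule ly_pullback[OF M.lie_yamaguti_axioms vector_space_twist _ _ _ j_hom])
  interpret T: vector_space "smult (twist G H C)"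
    by (rule vector_space_twist)
  show "T.subspace (carrier (twist G H C))"
    by simp
qed (use inj_j in simp_all)

lemma is_cocycle_induced: "is_cocycle G H C"
  using C.multilinear_septuple_axioms lie_yamaguti_twist by (simp add: is_cocycle_iff)

end

section \<open>Classification of extensions\<close>

text \<open>
  If \<^verbatim>\<open>R\<close> is the inverse image of an equivalence relation \<^verbatim>\<open>S\<close> under a map \<^verbatim>\<open>h\<close> that hits every class
  of \<^verbatim>\<open>S\<close>, then \<^verbatim>\<open>h\<close> induces a bijection of the quotients. The image of a class \<^verbatim>\<open>P\<close> is written
  as \<^verbatim>\<open>S `` h ` P\<close>, which avoids choosing a representative.
\<close>

lemma quotient_bij_betw:
  assumes S: "equiv B S" and R: "R = {(x, y). x \<in> A \<and> y \<in> A \<and> (h x, h y) \<in> S}"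
    and h: "\<And>x. x \<in> A \<Longrightarrow> h x \<in> B" and surj: "\<And>b. b \<in> B \<Longrightarrow> \<exists>x\<in>A. (h x, b) \<in> S"
  shows "equiv A R" and "\<And>x. x \<in> A \<Longrightarrow> S `` h ` R `` {x} = S `` {h x}"
    and "bij_betw (\<lambda>P. S `` h ` P) (A // R) (B // S)"
proof -
  have S': "refl_on B S" "sym S" "trans S"
    using S by (auto elim: equivE)
  show eq: "equiv A R"
  proof (rule equivI)
    show "R \<subseteq> A \<times> A" "refl_on A R"
      using S' h by (auto simp: R refl_on_def)
    show "sym R"
      using S' by (auto simp: R sym_def)
    show "trans R"
      unfolding R trans_def using S'(3) by (blast dest: transD)
  qed
  show \<Phi>: "S `` h ` R `` {x} = S `` {h x}" if x: "x \<in> A" for x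
  proof -
    have "S `` {h y} = S `` {h x}" if "(x, y) \<in> R" for y
      using that equiv_class_eq[OF S, of "h x" "h y"] by (simp add: R)
    moreover have "(x, x) \<in> R"
      using eq x by (meson equivE refl_onD)
    ultimately show ?thesis
      by blast
  qed
  show "bij_betw (\<lambda>P. S `` h ` P) (A // R) (B // S)"
  proof (rule bij_betwI')
    fix P Q assume "P \<in> A // R" "Q \<in> A // R"
    then obtain x y where xy: "P = R `` {x}" "x \<in> A" "Q = R `` {y}" "y \<in> A"
      by (elim quotientE) blast
    have "S `` {h x} = S `` {h y} \<longleftrightarrow> (x, y) \<in> R"
      using eq_equiv_class_iff[OF S] h xy by (simp add: R)
    also have "\<dots> \<longleftrightarrow> P = Q"
      using eq_equiv_class_iff[OF eq] xy by simp
    finally show "S `` h ` P = S `` h ` Q \<longleftrightarrow> P = Q"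
      using xy by (simp only: \<Phi>)
  next
    fix P assume "P \<in> A // R"
    then obtain x where "P = R `` {x}" "x \<in> A"
      by (elim quotientE)
    then show "S `` h ` P \<in> B // S"
      using h by (simp add: \<Phi> quotientI)
  next
    fix Q assume "Q \<in> B // S"
    then obtain b where b: "Q = S `` {b}" "b \<in> B"
      by (elim quotientE)
    then obtain x where x: "x \<in> A" "(h x, b) \<in> S"
      using surj by blast
    then have "Q = S `` h ` R `` {x}"
      using equiv_class_eq[OF S x(2)] b by (simp add: \<Phi>)
    then show "\<exists>P\<in>A // R. Q = S `` h ` P"
      using x(1) by (blast intro: quotientI)
  qed
qed

context ly_pair
begin

text \<open>
  An equivalence \<^verbatim>\<open>f\<close> maps \<^verbatim>\<open>s1 x + a\<close> to \<^verbatim>\<open>f (s1 x) + a\<close>, and \<^verbatim>\<open>f (s1 x)\<close> differs from \<^verbatim>\<open>s2 x\<close> by an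
  element \<^verbatim>\<open>\<phi> x\<close> of \<^verbatim>\<open>h\<close>; so in the coordinates given by the sections \<^verbatim>\<open>f\<close> is the shear along \<^verbatim>\<open>\<phi>\<close>.
  Conversely a homomorphic shear conjugates to an equivalence.
\<close>

lemma extension_equiv_iff_cocycle_equiv:
  fixes X1 X2 :: "('k, 'g, 'h, 'e::ab_group_add) extension"
  assumes X1: "is_extension G H X1" "is_section G X1 s1"
    and X2: "is_extension G H X2" "is_section G X2 s2"
  shows "(X1, X2) \<in> extension_equiv G H \<longleftrightarrow>
    (induced_cocycle G X1 s1, induced_cocycle G X2 s2) \<in> cocycle_equiv G H"
proof -
  interpret X1: split_extension G H X1 s1
    using X1 by unfold_locales
  interpret X2: split_extension G H X2 s2
    using X2 by unfold_locales
  show ?thesis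
  proof
    assume "(X1, X2) \<in> extension_equiv G H"
    then obtain f where f: "ly_hom X1.M X2.M f"
      and fi: "\<And>a. f (X1.i a) = X2.i a" and pf: "\<And>e. e \<in> carrier X1.M \<Longrightarrow> X2.p (f e) = X1.p e"
      by (auto simp: extension_equiv_def)
    have f_simps [simp]: "e \<in> carrier X1.M \<Longrightarrow> f e \<in> carrier X2.M"
      "e \<in> carrier X1.M \<Longrightarrow> e' \<in> carrier X1.M \<Longrightarrow> f (e + e') = f e + f e'"
      "e \<in> carrier X1.M \<Longrightarrow> f (smult X1.M c e) = smult X2.M c (f e)" for e e' c
      using f by (simp_all add: ly_hom_def linear_map_def)
    define \<phi> where "\<phi> x = inv X2.i (s2 x - f (s1 x))" for x
    have i_phi: "X2.i (\<phi> x) = s2 x - f (s1 x)" for x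
      unfolding \<phi>_def by (rule X2.i_inv) (simp_all add: X2.p_diff pf)
    have phi: "linear_map G H \<phi>"
      by (intro linear_map_UNIV_I)
        (auto intro!: injD[OF X2.inj_i] simp: X2.i_simps X2.s_simps X1.s_simps i_phi
          X2.M.scale_right_diff_distrib)
    have "ly_hom (twist G H X1.C) (twist G H X2.C) (shear \<phi>)"
    proof (rule ly_hom_cancel_left)
      show "ly_hom (twist G H X1.C) X2.M (\<lambda>u. f (X1.j u))"
        by (rule ly_hom_comp[OF X1.j_hom f])
      show "ly_hom (twist G H X2.C) X2.M X2.j" "inj_on X2.j (carrier (twist G H X2.C))"
        using X2.j_hom X2.inj_j by simp_all
      show "shear \<phi> u \<in> carrier (twist G H X2.C) \<and> X2.j (shear \<phi> u) = f (X1.j u)" for u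
        by (cases u) (simp add: X2.i_simps i_phi fi)
    qed (rule X1.lie_yamaguti_twist X2.lie_yamaguti_twist)+
    with phi show "(X1.C, X2.C) \<in> cocycle_equiv G H"
      using X1.is_cocycle_induced X2.is_cocycle_induced by (auto simp: cocycle_equiv_iff)
  next
    assume "(X1.C, X2.C) \<in> cocycle_equiv G H"
    then obtain \<phi> where phi: "linear_map G H \<phi>"
      and hom: "ly_hom (twist G H X1.C) (twist G H X2.C) (shear \<phi>)"
      by (auto simp: cocycle_equiv_iff)
    let ?g = "inv_into UNIV X1.j"
    have g: "X1.j (?g e) = e" if "e \<in> carrier X1.M" for e
      using X1.bij_j that by (intro f_inv_into_f) (simp add: bij_betw_def)
    have gj: "?g (X1.j u) = u" for u
      using X1.inj_j by simp
    have "ly_hom X1.M (twist G H X1.C) ?g"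
    proof (rule ly_hom_cancel_left)
      show "ly_hom X1.M X1.M (\<lambda>e. e)"
        by (simp add: ly_hom_def linear_map_def)
      show "ly_hom (twist G H X1.C) X1.M X1.j" "inj_on X1.j (carrier (twist G H X1.C))"
        using X1.j_hom X1.inj_j by simp_all
    qed (simp_all add: g X1.lie_yamaguti_twist X1.M.lie_yamaguti_axioms)
    from ly_hom_comp[OF ly_hom_comp[OF this hom] X2.j_hom]
    have "ly_hom X1.M X2.M (\<lambda>e. X2.j (shear \<phi> (?g e)))" .
    moreover have "X2.j (shear \<phi> (?g (X1.i a))) = X2.i a" for a
      using gj[of "(0, a)"] linear_map_UNIV[OF phi G_UNIV]
      by (simp add: X1.s_simps X2.s_simps)
    moreover have "X2.p (X2.j (shear \<phi> (?g e))) = X1.p e" if "e \<in> carrier X1.M" for e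
      using X1.p_j[of "?g e"] g[OF that] by (simp add: X2.p_j del: X1.j_simps X2.j_simps)
    ultimately show "(X1, X2) \<in> extension_equiv G H"
      using X1(1) X2(1) unfolding extension_equiv_def by blast
  qed
qed

text \<open>
  The twisted product of a cocycle, carried along the linear injection \<^verbatim>\<open>j\<close> to a subspace of the
  ambient vector space, with the section \<^verbatim>\<open>x \<mapsto> j (x, 0)\<close>.
\<close>

lemma extension_of_cocycle:
  assumes C: "is_cocycle G H C" and room: "has_room_for_extensions G H TYPE('e::ab_group_add)"
  obtains X :: "('k, 'g, 'h, 'e::ab_group_add) extension" and s
  where "is_extension G H X" and "is_section G X s" and "induced_cocycle G X s = C"
proof -
  interpret multilinear_septuple G H C
    using C by (rule multilinear_if_is_cocycle)
  have E: "lie_yamaguti (twist G H C)"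
    using C by (simp add: is_cocycle_iff)
  obtain sm :: "'k \<Rightarrow> 'e \<Rightarrow> 'e" and j :: "'g \<times> 'h \<Rightarrow> 'e"
    where lin_j: "Vector_Spaces.linear (\<lambda>c (x, a). (smult G c x, smult H c a)) sm j" and inj: "inj j"
    using room unfolding has_room_for_extensions_def by blast
  interpret j: Vector_Spaces.linear "\<lambda>c (x, a). (smult G c x, smult H c a)" sm j
    by (rule lin_j)
  note [simp] = inv_f_f[OF inj]
  have j_add: "j (x, a) + j (y, b) = j (x + y, a + b)" "j (x, a) - j (y, b) = j (x - y, a - b)"
    for x y a b
    by (simp_all flip: j.add j.diff)
  have j_scale: "sm c (j (x, a)) = j (smult G c x, smult H c a)" for c x a
    by (simp add: j.scale[symmetric])
  define M where "M = \<lparr> smult = sm, carrier = range j,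
    brk = (\<lambda>u v. j [inv j u, inv j v]\<^bsub>twist G H C\<^esub>),
    trp = (\<lambda>u v w. j {inv j u, inv j v, inv j w}\<^bsub>twist G H C\<^esub>) \<rparr>"
  have M [simp]: "smult M = sm" "carrier M = range j"
    "[u, v]\<^bsub>M\<^esub> = j [inv j u, inv j v]\<^bsub>twist G H C\<^esub>"
    "{u, v, w}\<^bsub>M\<^esub> = j {inv j u, inv j v, inv j w}\<^bsub>twist G H C\<^esub>" for u v w
    by (simp_all add: M_def)
  have inv_hom: "ly_hom M (twist G H C) (inv j)"
    by (auto simp: ly_hom_def linear_map_def j_add j_scale)
  have LY_M: "lie_yamaguti M"
  proof (rule ly_pullback[OF E _ _ _ _ inv_hom])
    show "vector_space (smult M)"
      by (simp add: j.vs2.vector_space_axioms)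
    show "module.subspace (smult M) (carrier M)"
      by (auto simp: j.vs2.subspace_def j_add j_scale intro: range_eqI[of _ _ 0] simp: j.zero)
    show "inj_on (inv j) (carrier M)"
      by (auto simp: inj_on_def)
  qed auto
  define X where "X = \<lparr> mid = M, inc = (\<lambda>a. j (0, a)), prj = (\<lambda>e. fst (inv j e)) \<rparr>"
  have X [simp]: "mid X = M" "inc X = (\<lambda>a. j (0, a))" "prj X = (\<lambda>e. fst (inv j e))"
    by (simp_all add: X_def)
  have inj_inc: "inj (\<lambda>a. j (0, a))"
    using inj by (auto simp: inj_on_def)
  note [simp] = inv_f_f[OF inj_inc]
  show thesis
  proof
    have "ly_hom H M (inc X)"
      by (auto simp: ly_hom_def linear_map_def j_add j_scale lin)
    moreover have "ly_hom M G (prj X)"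
      by (auto simp: ly_hom_def linear_map_def j_add j_scale lin)
    moreover have "inc X ` carrier H = {e \<in> carrier M. prj X e = 0}"
      by auto
    moreover have "prj X ` carrier M = carrier G"
      by (force simp: image_iff)
    ultimately show "is_extension G H X"
      using LY_M inj_inc by (simp add: is_extension_def)
    show "is_section G X (\<lambda>x. j (x, 0))"
      by (auto simp: is_section_def linear_map_def j_add j_scale)
    show "induced_cocycle G X (\<lambda>x. j (x, 0)) = C"
      by (simp add: induced_cocycle_def j_add lin)
  qed
qed

end

theorem proposition3p8:
  fixes G :: "('k::field, 'g::ab_group_add) ly_algebra"
    and H :: "('k, 'h::ab_group_add) ly_algebra"
  assumes "lie_yamaguti G" and "carrier G = UNIV"
    and "lie_yamaguti H" and "carrier H = UNIV"
    and "has_room_for_extensions G H TYPE('e::ab_group_add)"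
  shows "equiv {X :: ('k, 'g, 'h, 'e) extension. is_extension G H X} (extension_equiv G H) \<and>
    equiv {C. is_cocycle G H C} (cocycle_equiv G H) \<and>
    (\<forall>X :: ('k, 'g, 'h, 'e) extension. is_extension G H X \<longrightarrow>
      (\<exists>s. is_section G X s) \<and>
      (\<forall>s. is_section G X s \<longrightarrow> is_cocycle G H (induced_cocycle G X s))) \<and>
    (\<exists>\<Phi> :: ('k, 'g, 'h, 'e) extension set \<Rightarrow> ('g, 'h) septuple set.
      (\<forall>X s. is_extension G H X \<and> is_section G X s \<longrightarrow>
        \<Phi> (extension_equiv G H `` {X}) = cocycle_equiv G H `` {induced_cocycle G X s}) \<and>
      bij_betw \<Phi> (E_nab G H) (H23_nab G H))"
proof -
  interpret ly_pair G H
    using assms(1-4) by (rule ly_pair.intro)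
  let ?A = "{X :: ('k, 'g, 'h, 'e) extension. is_extension G H X}"
  let ?R = "extension_equiv G H :: ('k, 'g, 'h, 'e) extension rel"
  \<comment> \<open>Any choice of sections will do, since the class of the induced cocycle does not depend on it.\<close>
  define sec where "sec X = (SOME s. is_section G X s)" for X :: "('k, 'g, 'h, 'e) extension"
  define h where "h X = induced_cocycle G X (sec X)" for X
  have sec: "is_section G X (sec X)" if "is_extension G H X" for X
    unfolding sec_def using section_exists[OF that] by (rule someI_ex)
  have cocycle: "is_cocycle G H (induced_cocycle G X s)"
    if "is_extension G H X" "is_section G X s" for X :: "('k, 'g, 'h, 'e) extension" and s
    by (rule split_extension.is_cocycle_induced) (use that in unfold_locales)
  have R: "?R = {(X1, X2). X1 \<in> ?A \<and> X2 \<in> ?A \<and> (h X1, h X2) \<in> cocycle_equiv G H}"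
  proof -
    have "?R \<subseteq> ?A \<times> ?A"
      by (auto simp: extension_equiv_def)
    then show ?thesis
      using extension_equiv_iff_cocycle_equiv sec unfolding h_def by blast
  qed
  have h: "h X \<in> {C. is_cocycle G H C}" if "X \<in> ?A" for X
    using that by (simp add: h_def cocycle sec)
  \<comment> \<open>The extension X is equivalent to itself, whichever of its two sections is used on either side.\<close>
  have section_indep: "(h X, induced_cocycle G X s) \<in> cocycle_equiv G H"
    if X: "is_extension G H X" and s: "is_section G X s" for X s
  proof -
    have "(X, X) \<in> ?R"
      using X equivE[OF equiv_cocycle_equiv] h by (auto simp: R refl_on_def)
    then show ?thesis
      unfolding h_def using extension_equiv_iff_cocycle_equiv[OF X sec[OF X] X s] by simp
  qed
  have surj: "\<exists>X\<in>?A. (h X, C) \<in> cocycle_equiv G H" if "C \<in> {C. is_cocycle G H C}" for C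
  proof -
    have "is_cocycle G H C"
      using that by simp
    then obtain X :: "('k, 'g, 'h, 'e) extension" and s
      where "is_extension G H X" "is_section G X s" "induced_cocycle G X s = C"
      using assms(5) by (rule extension_of_cocycle)
    then show ?thesis
      using section_indep[of X s] by blast
  qed
  note main = quotient_bij_betw[OF equiv_cocycle_equiv R h surj]
  let ?\<Phi> = "\<lambda>P. cocycle_equiv G H `` h ` P"
  have \<Phi>: "?\<Phi> (?R `` {X}) = cocycle_equiv G H `` {induced_cocycle G X s}"
    if "is_extension G H X" "is_section G X s" for X s
    using main(2)[of X] that equiv_class_eq[OF equiv_cocycle_equiv section_indep] by simp
  have bij: "bij_betw ?\<Phi> (E_nab G H) (H23_nab G H)"
    using main(3) unfolding E_nab_def H23_nab_def .
  show ?thesis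
  proof (intro conjI allI impI exI[of _ ?\<Phi>])
    show "equiv ?A ?R"
      by (rule main(1))
    show "equiv {C. is_cocycle G H C} (cocycle_equiv G H)"
      by (rule equiv_cocycle_equiv)
    show "bij_betw ?\<Phi> (E_nab G H) (H23_nab G H)"
      by (rule bij)
  next
    fix X :: "('k, 'g, 'h, 'e) extension" and s
    assume "is_extension G H X \<and> is_section G X s"
    then show "?\<Phi> (?R `` {X}) = cocycle_equiv G H `` {induced_cocycle G X s}"
      by (intro \<Phi>) simp_all
  qed (use section_exists cocycle in simp_all)
qed

end
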